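(* Let $p>3$ be a prime with $\big(\frac p{23}\big)=1$. Then $$\sum_{k=0}^{[p/3]}\binom{3k}k\equiv\begin{cases}1\pmod p&\text{if }p=x^2+xy+52y^2\text{ or }p=8x^2+7xy+8y^2,\\ (39x-10y)/(23y)\pmod p&\text{if }p=13x^2+xy+4y^2\neq13,\\ -(87x+19y)/(23y)\pmod p&\text{if }p=29x^2+5xy+2y^2\neq 29,\end{cases}$$ where in each case $x,y\in\mathbb Z$.
   Context: $[x]$ denotes the greatest integer not exceeding $x$; $\big(\frac{\cdot}{\cdot}\big)$ is the Legendre symbol. Quotients of integers prime to $p$ are interpreted modulo $p$. *)

theory Defs
  imports "HOL-Number_Theory.Number_Theory"
begin

text \<open>
  The residue class modulo \<open>m\<close> of the quotient \<open>a / b\<close>, meaningful when \<open>b\<close> is coprime to \<open>m\<close>.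
\<close>
definition quot_mod :: "int \<Rightarrow> int \<Rightarrow> int \<Rightarrow> int" where
  "quot_mod m a b = a * modular_inverse m b"

lemma quot_mod_cong_iff:
  assumes "coprime b m"
  shows "[c = quot_mod m a b] (mod m) \<longleftrightarrow> [c * b = a] (mod m)"
proof -
  have "[quot_mod m a b * b = a * 1] (mod m)"
    unfolding quot_mod_def mult.assoc
    by (intro cong_mult cong_refl cong_modular_inverse2 assms)
  hence *: "[quot_mod m a b * b = a] (mod m)" by simp
  have "[c = quot_mod m a b] (mod m) \<longleftrightarrow> [c * b = quot_mod m a b * b] (mod m)"
    using assms by (simp add: cong_mult_rcancel)
  also have "\<dots> \<longleftrightarrow> [c * b = a] (mod m)"
    using * by (meson cong_sym cong_trans)
  finally show ?thesis .
qed

end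

theory Submission
  imports Defs "HOL-Computational_Algebra.Polynomial"
begin

text \<open>
  Modulo \<open>p\<close>, with \<open>n = [p/3]\<close>, one has \<open>binom(3k, k) \<equiv> (-27)^k binom(n + k, 2k)\<close>, so the sum is the
  value at \<open>-27\<close> of a Chebyshev-type polynomial of degree \<open>n\<close>. If \<open>p\<close> is represented by a form of discriminant \<open>-207\<close> with
  leading coefficient \<open>a\<close>, write \<open>4 a p = B\<^sup>2 + 207 y\<^sup>2\<close> and \<open>\<gamma> = (B - 9 y \<surd>(-3)) / 2\<close>. Then
  \<open>S N(\<gamma>)^n B \<equiv> \<gamma>^(2n+1) + \<gamma>'^(2n+1)\<close>, where \<open>\<gamma>'\<close> is the conjugate of \<open>\<gamma>\<close>, hence
  \<open>S B \<equiv> Tr(\<chi> \<gamma>)\<close> for the cubic residue symbol \<open>\<chi> = (\<gamma>/p)\<close>.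

  Cubic reciprocity between rational and Eisenstein integers gives \<open>(\<gamma>/p) = (p/\<gamma>)\<close>. From
  \<open>27 a p \<equiv> B\<^sup>2\<close> modulo \<open>N(\<gamma>)\<close> and \<open>(B/\<gamma>) = (\<gamma>/B) = 1\<close> one gets \<open>(p/\<gamma>) = (a/\<gamma>)\<^sup>-\<^sup>1 = (\<gamma>/a)\<^sup>-\<^sup>1\<close>,
  which depends on the form only.

  The reciprocity law comes from Gauss sums, realised as polynomials over the Eisenstein integers modulo
  \<open>X^l - 1\<close>: the \<open>q\<close>-th power of the Gauss sum is evaluated once through the Jacobi sum and
  once through the Frobenius congruence modulo \<open>q\<close>.
\<close>

section \<open>Congruences in commutative rings\<close>

text \<open>Divisibility in an arbitrary commutative ring lets one relation serve for Eisenstein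
  integers modulo a rational integer and for polynomials modulo a rational prime or modulo
  \<open>cyc l\<close>.\<close>

definition congr :: "'a::comm_ring_1 \<Rightarrow> 'a \<Rightarrow> 'a \<Rightarrow> bool" where
  "congr m a b \<longleftrightarrow> m dvd a - b"

lemma congr_refl [simp, intro]: "congr m a a"
  by (simp add: congr_def)

lemma congr_sym: "congr m a b \<Longrightarrow> congr m b a"
  unfolding congr_def by (metis dvd_minus_iff minus_diff_eq)

lemma congr_trans [trans]:
  assumes "congr m a b" "congr m b c"
  shows "congr m a c"
proof -
  have "a - c = (a - b) + (b - c)" by simp
  with assms show ?thesis unfolding congr_def by (metis dvd_add)
qed

lemma congr_add:
  assumes "congr m a b" "congr m c d"
  shows "congr m (a + c) (b + d)"
proof -
  have "(a + c) - (b + d) = (a - b) + (c - d)" by simp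
  with assms show ?thesis unfolding congr_def by (metis dvd_add)
qed

lemma congr_mult:
  assumes "congr m a b" "congr m c d"
  shows "congr m (a * c) (b * d)"
proof -
  have "a * c - b * d = (a - b) * c + b * (c - d)" by (simp add: algebra_simps)
  moreover have "m dvd (a - b) * c" "m dvd b * (c - d)"
    using assms unfolding congr_def by auto
  ultimately show ?thesis unfolding congr_def by (metis dvd_add)
qed

lemma congr_minus: "congr m a b \<Longrightarrow> congr m (- a) (- b)"
  using congr_mult [of m "- 1" "- 1" a b] by simp

lemma congr_diff: "congr m a b \<Longrightarrow> congr m c d \<Longrightarrow> congr m (a - c) (b - d)"
  using congr_add [of m a b "- c" "- d"] congr_minus by fastforce

lemma congr_power: "congr m a b \<Longrightarrow> congr m (a ^ n) (b ^ n)"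
  by (induction n) (auto intro: congr_mult)

lemma congr_sum: "(\<And>i. i \<in> A \<Longrightarrow> congr m (f i) (g i)) \<Longrightarrow> congr m (sum f A) (sum g A)"
  by (induction A rule: infinite_finite_induct) (auto intro: congr_add)

text \<open>The prime \<open>q\<close> divides every binomial coefficient strictly between the two
  ends. The ring is left general because the result is applied to polynomials over the Eisenstein
  integers.\<close>

lemma freshman_add:
  fixes x y :: "'a::comm_ring_1"
  assumes "prime q"
  shows "congr (of_nat q) ((x + y) ^ q) (x ^ q + y ^ q)"
proof -
  have q: "q > 0" using assms prime_gt_0_nat by blast
  have "(x + y) ^ q = (\<Sum>k\<le>q. of_nat (q choose k) * x ^ k * y ^ (q - k))"
    by (rule binomial_ring)
  also have "{..q} = insert 0 (insert q {0<..<q})" using q by auto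
  also have "(\<Sum>k\<in>insert 0 (insert q {0<..<q}). of_nat (q choose k) * x ^ k * y ^ (q - k))
     = y ^ q + (x ^ q + (\<Sum>k\<in>{0<..<q}. of_nat (q choose k) * x ^ k * y ^ (q - k)))"
    using q by simp
  finally have eq: "(x + y) ^ q - (x ^ q + y ^ q)
      = (\<Sum>k\<in>{0<..<q}. of_nat (q choose k) * x ^ k * y ^ (q - k))"
    by (simp add: algebra_simps)
  have "of_nat q dvd (of_nat (q choose k) * x ^ k * y ^ (q - k) :: 'a)" if "k \<in> {0<..<q}" for k
  proof -
    have "q dvd (q choose k)" using that assms by (intro dvd_choose_prime) auto
    hence "(of_nat q :: 'a) dvd of_nat (q choose k)" by auto
    thus ?thesis by (simp add: mult.assoc)
  qed
  hence "of_nat q dvd (x + y) ^ q - (x ^ q + y ^ q)"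
    unfolding eq by (intro dvd_sum) auto
  thus ?thesis by (simp add: congr_def)
qed

lemma freshman_sum:
  fixes f :: "'b \<Rightarrow> 'a::comm_ring_1"
  assumes "prime q"
  shows "congr (of_nat q) ((\<Sum>i\<in>A. f i) ^ q) (\<Sum>i\<in>A. f i ^ q)"
proof (induction A rule: infinite_finite_induct)
  case (insert a A)
  have "congr (of_nat q) ((f a + sum f A) ^ q) (f a ^ q + sum f A ^ q)"
    by (rule freshman_add [OF assms])
  also have "congr (of_nat q) \<dots> (f a ^ q + (\<Sum>i\<in>A. f i ^ q))"
    using insert by (intro congr_add) auto
  finally show ?case using insert by simp
qed (use assms prime_gt_0_nat in \<open>auto simp: power_0_left\<close>)

section \<open>Eisenstein integers\<close>

text \<open>\<open>Eis a b\<close> stands for a + b \<omega> with \<omega>^2 = -1 - \<omega>.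
  Conjugation sends \<omega> to -1 - \<omega>, so the trace of \<open>Eis a b\<close> is 2a -
  b.\<close>

datatype eis = Eis int int

instantiation eis :: comm_ring_1
begin

definition "0 = Eis 0 0"
definition "1 = Eis 1 0"
fun plus_eis where "Eis a b + Eis c d = Eis (a + c) (b + d)"
fun uminus_eis where "- Eis a b = Eis (- a) (- b)"
fun minus_eis where "Eis a b - Eis c d = Eis (a - c) (b - d)"
fun times_eis where "Eis a b * Eis c d = Eis (a * c - b * d) (a * d + b * c - b * d)"

instance
proof
  fix a b c :: eis
  show "a + b + c = a + (b + c)" by (cases a; cases b; cases c) simp
  show "a + b = b + a" by (cases a; cases b) simp
  show "0 + a = a" by (cases a) (simp add: zero_eis_def)
  show "- a + a = 0" by (cases a) (simp add: zero_eis_def)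
  show "a - b = a + - b" by (cases a; cases b) simp
  show "a * b * c = a * (b * c)" by (cases a; cases b; cases c) (simp add: algebra_simps)
  show "a * b = b * a" by (cases a; cases b) (simp add: algebra_simps)
  show "1 * a = a" by (cases a) (simp add: one_eis_def)
  show "(a + b) * c = a * c + b * c"
    by (cases a; cases b; cases c) (simp add: algebra_simps)
  show "(0::eis) \<noteq> 1" by (simp add: zero_eis_def one_eis_def)
qed

end

lemma of_nat_eis: "of_nat n = Eis (int n) 0"
  by (induction n) (auto simp: zero_eis_def one_eis_def)

lemma of_int_eis: "of_int n = Eis n 0"
  by (cases n) (auto simp: of_nat_eis one_eis_def)

lemma of_int_dvd_Eis_iff: "of_int n dvd Eis a b \<longleftrightarrow> n dvd a \<and> n dvd b"
proof
  assume "of_int n dvd Eis a b"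
  then obtain z where "Eis a b = of_int n * z" by (elim dvdE)
  thus "n dvd a \<and> n dvd b" by (cases z) (auto simp: of_int_eis)
next
  assume "n dvd a \<and> n dvd b"
  then obtain a' b' where "a = n * a'" "b = n * b'" by (auto elim!: dvdE)
  hence "Eis a b = of_int n * Eis a' b'" by (simp add: of_int_eis)
  thus "of_int n dvd Eis a b" by (metis dvd_triv_left)
qed

lemma of_int_dvd_of_int_eis: "(of_int n :: eis) dvd of_int m \<longleftrightarrow> n dvd m"
  by (simp add: of_int_eis [of m] of_int_dvd_Eis_iff)

definition \<omega> :: eis where "\<omega> = Eis 0 1"

lemma omega_power: "\<omega> ^ 2 = Eis (-1) (-1)" "\<omega> ^ 3 = 1"
  by (simp_all add: \<omega>_def eval_nat_numeral one_eis_def)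

fun conj_eis :: "eis \<Rightarrow> eis" where "conj_eis (Eis a b) = Eis (a - b) (- b)"

fun nrm :: "eis \<Rightarrow> int" where "nrm (Eis a b) = a\<^sup>2 - a * b + b\<^sup>2"

lemma conj_eis_mult: "conj_eis (x * y) = conj_eis x * conj_eis y"
  by (cases x; cases y) (simp add: algebra_simps)

lemma conj_eis_add: "conj_eis (x + y) = conj_eis x + conj_eis y"
  by (cases x; cases y) simp

lemma conj_eis_diff: "conj_eis (x - y) = conj_eis x - conj_eis y"
  by (cases x; cases y) simp

lemma conj_eis_of_int [simp]: "conj_eis (of_int n) = of_int n"
  by (simp add: of_int_eis)

lemma conj_eis_0 [simp]: "conj_eis 0 = 0" and conj_eis_1 [simp]: "conj_eis 1 = 1"
  by (simp_all add: zero_eis_def one_eis_def)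

lemma conj_eis_power: "conj_eis (x ^ n) = conj_eis x ^ n"
  by (induction n) (auto simp: conj_eis_mult)

lemma conj_eis_sum: "conj_eis (\<Sum>i\<in>A. f i) = (\<Sum>i\<in>A. conj_eis (f i))"
  by (induction A rule: infinite_finite_induct) (auto simp: conj_eis_add)

lemma conj_eis_conj_eis [simp]: "conj_eis (conj_eis x) = x"
  by (cases x) simp

lemma mult_conj_eis: "x * conj_eis x = of_int (nrm x)"
  by (cases x) (simp add: of_int_eis algebra_simps power2_eq_square)

lemma nrm_mult: "nrm (x * y) = nrm x * nrm y"
  by (cases x; cases y) (simp add: algebra_simps power2_eq_square)

lemma nrm_nonneg: "nrm x \<ge> 0"
proof (cases x)
  case (Eis a b)
  have "4 * nrm x = (2 * a - b)\<^sup>2 + 3 * b\<^sup>2"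
    by (simp add: Eis power2_eq_square algebra_simps)
  moreover have "(2 * a - b)\<^sup>2 + 3 * b\<^sup>2 \<ge> 0" by simp
  ultimately show ?thesis by linarith
qed

lemma congr_conj_eis: "congr (of_int n) x y \<Longrightarrow> congr (of_int n) (conj_eis x) (conj_eis y)"
  unfolding congr_def by (metis conj_eis_diff conj_eis_mult conj_eis_of_int dvd_def)

lemma congr_conj_eis_nat: "congr (of_nat n) x y \<Longrightarrow> congr (of_nat n) (conj_eis x) (conj_eis y)"
  using congr_conj_eis [of "int n"] by simp

definition omega_powers :: "eis set" where "omega_powers = {1, \<omega>, \<omega>\<^sup>2}"

lemma omega_powers_eq: "omega_powers = {Eis 1 0, Eis 0 1, Eis (-1) (-1)}"
  by (simp add: omega_powers_def omega_power one_eis_def) (simp add: \<omega>_def)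

lemma omega_powers_mult: "x \<in> omega_powers \<Longrightarrow> y \<in> omega_powers \<Longrightarrow> x * y \<in> omega_powers"
  by (auto simp: omega_powers_eq)

lemma omega_powers_cube: "x \<in> omega_powers \<Longrightarrow> x ^ 3 = 1"
  by (auto simp: omega_powers_eq one_eis_def eval_nat_numeral)

lemma omega_powers_conj: "x \<in> omega_powers \<Longrightarrow> conj_eis x = x\<^sup>2"
  by (auto simp: omega_powers_eq eval_nat_numeral)

lemma omega_powers_mod_3:
  assumes "x \<in> omega_powers"
  shows "x ^ n = x ^ (n mod 3)"
proof -
  have "x ^ n = x ^ (3 * (n div 3) + n mod 3)" by simp
  also have "\<dots> = (x ^ 3) ^ (n div 3) * x ^ (n mod 3)" by (simp only: power_add power_mult)
  finally show ?thesis using omega_powers_cube [OF assms] by simp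
qed

text \<open>The difference of two distinct cube roots of unity has a coordinate equal to 1 or -1, so
  such a \<open>q\<close> cannot divide it. Congruences between symbols thereby become
  equalities.\<close>

lemma omega_powers_eqI:
  assumes "x \<in> omega_powers" "y \<in> omega_powers" "congr (of_int q) x y" "\<bar>q\<bar> \<noteq> 1"
  shows "x = y"
proof -
  have *: "\<not> q dvd 1" "\<not> q dvd - 1" using assms(4) by auto
  thus ?thesis
    using assms(1-3)
    by (auto simp: omega_powers_eq congr_def of_int_dvd_Eis_iff)
qed

section \<open>The ring of polynomials modulo \<open>X ^ l - 1\<close>\<close>

definition cyc :: "nat \<Rightarrow> 'a::comm_ring_1 poly" where
  "cyc l = monom 1 l - 1"

lemma congr_cyc_monom:
  "congr (cyc l) (monom c n) (monom (c::'a::comm_ring_1) (n mod l))"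
proof -
  have "congr (cyc l) (monom (1::'a) l) 1" by (simp add: congr_def cyc_def)
  hence "congr (cyc l) (monom (1::'a) l ^ (n div l)) (1 ^ (n div l))" by (rule congr_power)
  hence "congr (cyc l) (monom (1::'a) (l * (n div l))) 1"
    by (simp add: monom_power)
  hence "congr (cyc l) (monom (1::'a) (l * (n div l)) * monom c (n mod l)) (1 * monom c (n mod l))"
    by (intro congr_mult) auto
  thus ?thesis by (simp add: mult_monom)
qed

text \<open>For \<open>l\<close> > 1 this is the coefficient of X after reduction modulo X^l - 1. It
  is a linear functional that respects both congruence modulo \<open>cyc l\<close> and congruence
  modulo an integer, so identities for Gauss sums can be read off in the coefficient ring.\<close>

definition cyc_coeff :: "nat \<Rightarrow> 'a::comm_ring_1 poly \<Rightarrow> 'a" where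
  "cyc_coeff l P = (\<Sum>i\<le>degree P. if i mod l = 1 then coeff P i else 0)"

lemma cyc_coeff_eq:
  assumes "degree P \<le> N"
  shows "cyc_coeff l P = (\<Sum>i\<le>N. if i mod l = 1 then coeff P i else 0)"
  unfolding cyc_coeff_def
  using assms by (intro sum.mono_neutral_left) (auto intro: le_degree)

lemma cyc_coeff_add: "cyc_coeff l (P + Q) = cyc_coeff l P + cyc_coeff l Q"
proof -
  let ?N = "max (degree P) (degree Q)"
  have "degree (P + Q) \<le> ?N" by (rule degree_add_le_max)
  thus ?thesis
    by (simp add: cyc_coeff_eq [of _ ?N] sum.distrib [symmetric]) (intro sum.cong, auto)
qed

lemma cyc_coeff_smult: "cyc_coeff l (smult c P) = c * cyc_coeff l P"
  using degree_smult_le [of c P]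
  by (simp add: cyc_coeff_eq [of _ "degree P"] sum_distrib_left) (intro sum.cong, auto)

lemma cyc_coeff_0 [simp]: "cyc_coeff l 0 = 0"
  by (simp add: cyc_coeff_def)

lemma cyc_coeff_sum: "cyc_coeff l (\<Sum>i\<in>A. f i) = (\<Sum>i\<in>A. cyc_coeff l (f i))"
  by (induction A rule: infinite_finite_induct) (auto simp: cyc_coeff_add)

lemma cyc_coeff_diff: "cyc_coeff l (P - Q) = cyc_coeff l P - cyc_coeff l Q"
  using cyc_coeff_add [of l "P - Q" Q] by (simp add: algebra_simps)

lemma cyc_coeff_monom: "cyc_coeff l (monom c n) = (if n mod l = 1 then c else 0)"
proof -
  have "cyc_coeff l (monom c n) = (\<Sum>i\<le>n. if i mod l = 1 then coeff (monom c n) i else 0)"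
    by (intro cyc_coeff_eq degree_monom_le)
  also have "\<dots> = (\<Sum>i\<le>n. if i = n then (if n mod l = 1 then c else 0) else 0)"
    by (intro sum.cong) auto
  finally show ?thesis by simp
qed

text \<open>Multiplication by X^l shifts every exponent by \<open>l\<close> and leaves its residue
  unchanged, so the functional vanishes on multiples of X^l - 1.\<close>

lemma cyc_coeff_cong_cyc:
  assumes "congr (cyc l) P Q"
  shows "cyc_coeff l P = cyc_coeff l Q"
proof -
  obtain R where R: "P - Q = cyc l * R" using assms by (auto simp: congr_def)
  have "cyc_coeff l (cyc l * R) = cyc_coeff l (monom 1 l * R) - cyc_coeff l R"
    by (simp add: cyc_def left_diff_distrib cyc_coeff_diff)
  also have "cyc_coeff l (monom 1 l * R)
      = cyc_coeff l (monom 1 l * (\<Sum>i\<le>degree R. monom (coeff R i) i))"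
    by (simp add: poly_as_sum_of_monoms)
  also have "\<dots> = cyc_coeff l (\<Sum>i\<le>degree R. monom (coeff R i) i)"
    by (simp add: sum_distrib_left mult_monom cyc_coeff_sum cyc_coeff_monom)
  also have "\<dots> = cyc_coeff l R" by (simp add: poly_as_sum_of_monoms)
  finally have "cyc_coeff l (P - Q) = 0" by (simp add: R)
  thus ?thesis by (simp add: cyc_coeff_diff)
qed

lemma cyc_coeff_cong_of_nat:
  assumes "congr (of_nat q) P Q"
  shows "congr (of_nat q) (cyc_coeff l P) (cyc_coeff l Q)"
proof -
  obtain R where R: "P - Q = of_nat q * R" using assms by (auto simp: congr_def)
  have "cyc_coeff l (P - Q) = of_nat q * cyc_coeff l R"
    unfolding R by (simp add: of_nat_poly cyc_coeff_smult)
  thus ?thesis by (simp add: cyc_coeff_diff congr_def)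
qed

text \<open>A map that is injective modulo \<open>l\<close> permutes the residues by finiteness. It
  is used for translations and for multiplication by a unit.\<close>

lemma sum_residues_reindex:
  fixes f :: "int \<Rightarrow> 'a::comm_monoid_add" and \<phi> :: "int \<Rightarrow> int"
  assumes "l > 0"
    and per: "\<And>a b. [a = b] (mod int l) \<Longrightarrow> f a = f b"
    and inj: "\<And>a b. [\<phi> a = \<phi> b] (mod int l) \<Longrightarrow> [a = b] (mod int l)"
  shows "(\<Sum>k<l. f (\<phi> (int k))) = (\<Sum>k<l. f (int k))"
proof -
  define h where "h k = nat (\<phi> (int k) mod int l)" for k
  have h: "int (h k) = \<phi> (int k) mod int l" for k
    using assms(1) by (simp add: h_def)
  have "inj_on h {..<l}"
  proof (rule inj_onI)
    fix a b assume ab: "a \<in> {..<l}" "b \<in> {..<l}" "h a = h b"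
    hence "[\<phi> (int a) = \<phi> (int b)] (mod int l)" using h by (metis cong_def)
    hence "[int a = int b] (mod int l)" by (rule inj)
    thus "a = b" using ab by (simp add: cong_def)
  qed
  moreover have "h ` {..<l} \<subseteq> {..<l}"
    using assms(1) h by (auto simp: h_def nat_less_iff)
  ultimately have bij: "bij_betw h {..<l} {..<l}"
    by (simp add: bij_betw_def endo_inj_surj)
  have "(\<Sum>k<l. f (\<phi> (int k))) = (\<Sum>k<l. f (int (h k)))"
    by (intro sum.cong refl per) (simp add: h cong_def)
  also have "\<dots> = (\<Sum>k<l. f (int k))"
    by (rule sum.reindex_bij_betw [OF bij])
  finally show ?thesis .
qed

definition cyc_poly :: "nat \<Rightarrow> (int \<Rightarrow> 'a::comm_ring_1) \<Rightarrow> 'a poly" where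
  "cyc_poly l f = (\<Sum>k<l. monom (f (int k)) k)"

text \<open>Since exponents add modulo \<open>l\<close>, the product is a cyclic convolution.
  Periodicity of \<open>g\<close> enters because \<open>c - int a\<close> may be negative.\<close>

lemma cyc_poly_mult:
  fixes f g :: "int \<Rightarrow> 'a::comm_ring_1"
  assumes "l > 0" and per: "\<And>a b. [a = b] (mod int l) \<Longrightarrow> g a = g b"
  shows "congr (cyc l) (cyc_poly l f * cyc_poly l g)
           (cyc_poly l (\<lambda>c. \<Sum>a<l. f (int a) * g (c - int a)))"
proof -
  have "cyc_poly l f * cyc_poly l g
      = (\<Sum>a<l. \<Sum>b<l. monom (f (int a) * g (int b)) (a + b))"
    by (simp add: cyc_poly_def sum_product mult_monom)
  also have "congr (cyc l) \<dots> (\<Sum>a<l. \<Sum>b<l. monom (f (int a) * g (int b)) ((a + b) mod l))"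
    by (intro congr_sum congr_cyc_monom)
  also have "\<dots> = (\<Sum>a<l. \<Sum>c<l. monom (f (int a) * g (int c - int a)) c)"
  proof (rule sum.cong [OF refl])
    fix a
    define h where "h c = monom (f (int a) * g (c - int a)) (nat (c mod int l))" for c
    have "(\<Sum>b<l. h (int a + int b)) = (\<Sum>c<l. h (int c))"
    proof (rule sum_residues_reindex [OF assms(1)])
      fix u v :: int assume uv: "[u = v] (mod int l)"
      hence "[u - int a = v - int a] (mod int l)" by (intro cong_diff) auto
      hence "g (u - int a) = g (v - int a)" by (rule per)
      thus "h u = h v" using uv by (simp add: h_def cong_def)
    qed (simp add: cong_add_lcancel)
    moreover have "nat ((int a + int b) mod int l) = (a + b) mod l" for b
      by (metis nat_int of_nat_add of_nat_mod)
    ultimately show "(\<Sum>b<l. monom (f (int a) * g (int b)) ((a + b) mod l))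
        = (\<Sum>c<l. monom (f (int a) * g (int c - int a)) c)"
      by (simp add: h_def nat_mod_as_int [symmetric])
  qed
  also have "\<dots> = (\<Sum>c<l. \<Sum>a<l. monom (f (int a) * g (int c - int a)) c)"
    by (rule sum.swap)
  also have "\<dots> = cyc_poly l (\<lambda>c. \<Sum>a<l. f (int a) * g (c - int a))"
    by (simp add: cyc_poly_def monom_sum)
  finally show ?thesis .
qed

section \<open>Cubic residue characters and their Jacobi sums\<close>

lemma fermat_theorem_int:
  fixes m :: int
  assumes prime_l: "prime l" and "\<not> int l dvd m"
  shows "[m ^ (l - 1) = 1] (mod int l)"
proof -
  define k where "k = nat (m mod int l)"
  have k: "int k = m mod int l" using prime_gt_1_nat [OF prime_l] by (simp add: k_def)
  hence "\<not> l dvd k" using assms(2) by (metis dvd_mod_iff dvd_refl int_dvd_int_iff)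
  hence "[k ^ (l - 1) = 1] (mod l)" using fermat_theorem prime_l by blast
  hence "[int k ^ (l - 1) = 1] (mod int l)" by (metis cong_int_iff of_nat_1 of_nat_power)
  moreover have "[int k ^ (l - 1) = m ^ (l - 1)] (mod int l)"
    by (intro cong_pow) (simp add: k cong_def)
  ultimately show ?thesis by (metis cong_sym cong_trans)
qed

text \<open>The root \<open>t\<close> is a primitive cube root of unity modulo \<open>l\<close>.
  Choosing it amounts to choosing a prime of the Eisenstein integers above \<open>l\<close>, namely
  the kernel of \<omega> \<mapsto> t into the field with \<open>l\<close> elements.\<close>

locale cubic_character =
  fixes l :: nat and t :: int
  assumes prime_l: "prime l" and l_mod_3: "l mod 3 = 1"
    and root: "int l dvd t\<^sup>2 + t + 1"
begin

definition e :: nat where "e = (l - 1) div 3"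

lemma l_eq: "l = 3 * e + 1" and e_pos: "e > 0" and l_gt_1: "l > 1"
proof -
  show "l > 1" using prime_l by (rule prime_gt_1_nat)
  thus "l = 3 * e + 1" using l_mod_3 unfolding e_def by presburger
  thus "e > 0" using \<open>l > 1\<close> by auto
qed

lemma prime_int_l: "prime (int l)" using prime_l by simp

lemma not_l_dvd_3: "\<not> int l dvd 3"
proof
  assume "int l dvd 3"
  hence "l dvd 3" by (metis int_dvd_int_iff of_nat_numeral)
  hence "l \<le> 3" by (rule dvd_imp_le) simp
  thus False using l_eq e_pos by linarith
qed

text \<open>An integer lift of the reduction \<omega> \<mapsto> t, hence additive on the nose but
  multiplicative only modulo \<open>l\<close>.\<close>

fun ev :: "eis \<Rightarrow> int" where "ev (Eis a b) = a + b * t"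

lemma ev_add: "ev (x + y) = ev x + ev y"
  by (cases x; cases y) (simp add: algebra_simps)

lemma ev_sum: "ev (\<Sum>i\<in>A. f i) = (\<Sum>i\<in>A. ev (f i))"
  by (induction A rule: infinite_finite_induct) (auto simp: ev_add zero_eis_def)

lemma ev_mult: "[ev (x * y) = ev x * ev y] (mod int l)"
proof (cases x; cases y)
  fix a b c d assume xy: "x = Eis a b" "y = Eis c d"
  have "ev x * ev y - ev (x * y) = b * d * (t\<^sup>2 + t + 1)"
    by (simp add: xy algebra_simps power2_eq_square)
  hence "[ev x * ev y = ev (x * y)] (mod int l)" using root by (simp add: cong_iff_dvd_diff)
  thus ?thesis by (rule cong_sym)
qed

text \<open>Up to sign these are the differences of 0, 1, t and -1 - t. Each of them, if divisible
  by \<open>l\<close>, would force \<open>l\<close> to divide 1 or 3. This makes \<open>ev\<close>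
  injective on zero and the cube roots of unity.\<close>

lemma root_differences:
  "\<not> int l dvd 1" "\<not> int l dvd t" "\<not> int l dvd t + 1"
  "\<not> int l dvd t - 1" "\<not> int l dvd t + 2" "\<not> int l dvd 2 * t + 1"
proof -
  have *: "int l dvd u \<Longrightarrow> t\<^sup>2 + t + 1 - u * v = w \<Longrightarrow> int l dvd w" for u v w
    using root by (metis dvd_diff dvd_mult2)
  show 1: "\<not> int l dvd 1" using l_gt_1 by simp
  show "\<not> int l dvd t" using *[of t "t + 1" 1] 1 by (auto simp: algebra_simps power2_eq_square)
  show "\<not> int l dvd t + 1" using *[of "t + 1" t 1] 1 by (auto simp: algebra_simps power2_eq_square)
  show "\<not> int l dvd t - 1" using *[of "t - 1" "t + 2" 3] not_l_dvd_3
    by (auto simp: algebra_simps power2_eq_square)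
  show "\<not> int l dvd t + 2" using *[of "t + 2" "t - 1" 3] not_l_dvd_3
    by (auto simp: algebra_simps power2_eq_square)
  show "\<not> int l dvd 2 * t + 1"
  proof
    assume "int l dvd 2 * t + 1"
    hence "int l dvd 4 * (t\<^sup>2 + t + 1) - (2 * t + 1) * (2 * t + 1)"
      using root by (intro dvd_diff dvd_mult dvd_mult2)
    thus False using not_l_dvd_3 by (simp add: algebra_simps power2_eq_square)
  qed
qed

lemma ev_inj:
  assumes "x \<in> insert 0 omega_powers" "y \<in> insert 0 omega_powers" "[ev x = ev y] (mod int l)"
  shows "x = y"
proof -
  have d: "int l dvd ev x - ev y" "int l dvd ev y - ev x"
    using assms(3) cong_sym cong_iff_dvd_diff by blast+
  have *: "\<not> int l dvd - 1" "\<not> int l dvd - t" "\<not> int l dvd - 1 - t" "\<not> int l dvd 1 + t"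
    "\<not> int l dvd 1 - t" "\<not> int l dvd 2 + t" "\<not> int l dvd - t - 2"
    "\<not> int l dvd t - (- 1 - t)" "\<not> int l dvd 1 - (- 1 - t)" "\<not> int l dvd - 1 - t - t"
    using root_differences dvd_minus_iff [of "int l" "t + 1"] dvd_minus_iff [of "int l" "t - 1"]
      dvd_minus_iff [of "int l" "t + 2"] dvd_minus_iff [of "int l" "2 * t + 1"]
    by (simp_all add: algebra_simps)
  show ?thesis
    using assms(1,2) d root_differences * by (auto simp: omega_powers_eq zero_eis_def algebra_simps)
qed

text \<open>The power m^((l-1)/3) is zero or a cube root of unity modulo \<open>l\<close>, and each
  of these lifts through \<open>ev\<close>. By \<open>ev_inj\<close> the lift is unique, which makes
  the character below well defined.\<close>

lemma chi_exists: "\<exists>z\<in>insert 0 omega_powers. [ev z = m ^ e] (mod int l)"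
proof (cases "int l dvd m")
  case True
  hence "int l dvd m ^ e" using e_pos by (simp add: dvd_power_le dvd_trans dvd_power)
  hence "[ev 0 = m ^ e] (mod int l)" by (simp add: zero_eis_def cong_sym_eq [of 0] cong_0_iff)
  thus ?thesis by blast
next
  case False
  define x where "x = m ^ e"
  have "l - 1 = e * 3" using l_eq by linarith
  hence "x ^ 3 = m ^ (l - 1)" by (simp add: x_def power_mult [symmetric])
  hence "int l dvd x ^ 3 - 1" using fermat_theorem_int [OF prime_l False] by (simp add: cong_iff_dvd_diff)
  \<comment> \<open>Modulo \<open>l\<close> the roots of x^3 - 1 are 1, t and -1 - t. Subtracting a
    multiple of t^2 + t + 1 turns this splitting into an exact identity over the integers.\<close>
  hence "int l dvd (x ^ 3 - 1) - (x - 1) * (t\<^sup>2 + t + 1)" using root by auto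
  also have "(x ^ 3 - 1) - (x - 1) * (t\<^sup>2 + t + 1) = (x - 1) * ((x - t) * (x - (- 1 - t)))"
    by (simp add: algebra_simps power2_eq_square power3_eq_cube)
  finally have "int l dvd x - 1 \<or> int l dvd x - t \<or> int l dvd x - (- 1 - t)"
    using prime_int_l prime_dvd_mult_iff by blast
  hence "[x = ev (Eis 1 0)] (mod int l) \<or> [x = ev (Eis 0 1)] (mod int l)
      \<or> [x = ev (Eis (-1) (-1))] (mod int l)"
    by (simp add: cong_iff_dvd_diff)
  hence "[ev (Eis 1 0) = x] (mod int l) \<or> [ev (Eis 0 1) = x] (mod int l)
      \<or> [ev (Eis (-1) (-1)) = x] (mod int l)"
    by (simp only: cong_sym_eq [of x])
  moreover have "Eis 1 0 \<in> omega_powers" "Eis 0 1 \<in> omega_powers" "Eis (-1) (-1) \<in> omega_powers"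
    by (simp_all add: omega_powers_eq)
  ultimately show ?thesis unfolding x_def [symmetric] by blast
qed

section \<open>The cubic residue character modulo \<open>l\<close>\<close>

definition chi :: "int \<Rightarrow> eis" where
  "chi m = (THE z. z \<in> insert 0 omega_powers \<and> [ev z = m ^ e] (mod int l))"

lemma chi_eqI:
  assumes "z \<in> insert 0 omega_powers" "[ev z = m ^ e] (mod int l)"
  shows "chi m = z"
  unfolding chi_def
proof (rule the_equality)
  fix w assume w: "w \<in> insert 0 omega_powers \<and> [ev w = m ^ e] (mod int l)"
  hence "[ev w = ev z] (mod int l)" using cong_trans cong_sym [OF assms(2)] by blast
  thus "w = z" by (intro ev_inj conjunct1 [OF w] assms(1))
qed (use assms in blast)

lemma chi_in: "chi m \<in> insert 0 omega_powers" and ev_chi: "[ev (chi m) = m ^ e] (mod int l)"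
proof -
  obtain z where z: "z \<in> insert 0 omega_powers" "[ev z = m ^ e] (mod int l)"
    using chi_exists [of m] by blast
  hence "chi m = z" by (rule chi_eqI)
  with z show "chi m \<in> insert 0 omega_powers" "[ev (chi m) = m ^ e] (mod int l)" by simp_all
qed

lemma chi_cong: "[m = n] (mod int l) \<Longrightarrow> chi m = chi n"
  by (rule chi_eqI [OF chi_in]) (rule cong_trans [OF ev_chi cong_pow [OF cong_sym]])

lemma chi_square_cong: "[m = n] (mod int l) \<Longrightarrow> chi m ^ 2 = chi n ^ 2"
  by (simp add: chi_cong)

lemma chi_mult: "chi (m * n) = chi m * chi n"
proof (rule chi_eqI)
  show "chi m * chi n \<in> insert 0 omega_powers"
    using chi_in [of m] chi_in [of n] omega_powers_mult by auto
  have "[ev (chi m * chi n) = ev (chi m) * ev (chi n)] (mod int l)" by (rule ev_mult)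
  also have "[ev (chi m) * ev (chi n) = m ^ e * n ^ e] (mod int l)"
    by (intro cong_mult ev_chi)
  finally show "[ev (chi m * chi n) = (m * n) ^ e] (mod int l)" by (simp add: power_mult_distrib)
qed

lemma chi_eq_0_iff: "chi m = 0 \<longleftrightarrow> int l dvd m"
proof -
  have "chi m = 0 \<longleftrightarrow> [0 = m ^ e] (mod int l)"
    using ev_chi [of m] chi_eqI [of 0 m] by (auto simp: zero_eis_def)
  also have "\<dots> \<longleftrightarrow> int l dvd m ^ e"
    by (simp only: cong_sym_eq [of 0] cong_0_iff)
  also have "\<dots> \<longleftrightarrow> int l dvd m"
    using prime_int_l e_pos by (simp add: prime_dvd_power_iff)
  finally show ?thesis .
qed

lemma chi_omega: "\<not> int l dvd m \<Longrightarrow> chi m \<in> omega_powers"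
  using chi_in [of m] chi_eq_0_iff [of m] by auto

lemma chi_1 [simp]: "chi 1 = 1"
  by (rule chi_eqI) (auto simp: omega_powers_def one_eis_def)

text \<open>The number -1 is its own cube, so its value is a cube root of unity equal to its own
  cube.\<close>

lemma chi_minus_1: "chi (- 1) = 1"
proof -
  have "chi (- 1) ^ 3 = chi ((- 1) * ((- 1) * (- 1)))"
    unfolding chi_mult by (simp add: power3_eq_cube mult.assoc)
  moreover have "chi (- 1) ^ 3 = 1"
    using root_differences(1) by (intro omega_powers_cube chi_omega) simp
  ultimately show ?thesis by simp
qed

lemma chi_minus [simp]: "chi (- m) = chi m"
  using chi_mult [of "- 1" m] chi_minus_1 by simp

lemma chi_conj: "conj_eis (chi m) = chi m ^ 2"
  using chi_in [of m] omega_powers_conj by auto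

lemma chi_power4: "chi m ^ 4 = chi m"
proof -
  have "chi m ^ 4 = chi m * chi m ^ 3" by (simp add: eval_nat_numeral)
  thus ?thesis using chi_in [of m] omega_powers_cube by auto
qed

section \<open>Character sums and the Jacobi sum\<close>

lemma primitive_root:
  obtains g where "\<not> int l dvd g" "\<And>j. 0 < j \<Longrightarrow> j < l - 1 \<Longrightarrow> \<not> [g ^ j = 1] (mod int l)"
proof -
  obtain g where g: "residue_primroot l g"
    using prime_primitive_root_exists [of l] prime_l prime_gt_1_nat by blast
  have "coprime l g" and o: "ord l g = l - 1"
    using g prime_l by (auto simp: residue_primroot_def totient_prime)
  hence "\<not> l dvd g" using prime_l by (metis coprime_absorb_left not_prime_unit)
  moreover have "\<not> [int g ^ j = 1] (mod int l)" if "0 < j" "j < l - 1" for j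
  proof
    assume "[int g ^ j = 1] (mod int l)"
    hence "[g ^ j = 1] (mod l)" by (metis cong_int_iff of_nat_1 of_nat_power)
    hence "l - 1 dvd j" using ord_divides o by metis
    thus False using that by (auto dest: dvd_imp_le)
  qed
  ultimately show ?thesis using that [of "int g"] by auto
qed

lemma cong_mult_l_cancel:
  assumes "\<not> int l dvd c" "[c * a = c * b] (mod int l)"
  shows "[a = b] (mod int l)"
proof -
  have "coprime c (int l)" using assms(1) prime_int_l prime_imp_coprime coprime_commute by blast
  thus ?thesis using assms(2) cong_mult_lcancel by blast
qed

text \<open>Multiplying the residues by a primitive root \<open>g\<close> gives
  \<open>chi g * S = S\<close> with \<open>chi g\<close> different from 1. Adding S,
  \<open>chi g * S\<close> and its next multiple gives 3S = 0, where 3 can be cancelled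
  coordinatewise.\<close>

lemma chi_sum: "(\<Sum>k<l. chi (int k)) = 0"
proof -
  define S where "S = (\<Sum>k<l. chi (int k))"
  obtain g where g: "\<not> int l dvd g" "\<And>j. 0 < j \<Longrightarrow> j < l - 1 \<Longrightarrow> \<not> [g ^ j = 1] (mod int l)"
    using primitive_root by blast
  have "e < l - 1" using l_eq e_pos by linarith
  hence "\<not> [g ^ e = 1] (mod int l)" using g(2) [of e] e_pos by simp
  moreover have "[g ^ e = 1] (mod int l)" if "chi g = 1"
    using cong_sym [OF ev_chi [of g]] that by (simp add: one_eis_def)
  ultimately have "chi g \<noteq> 1" by blast
  hence *: "1 + chi g + chi g * chi g = 0"
    using chi_omega [OF g(1)] by (auto simp: omega_powers_eq one_eis_def zero_eis_def)
  have "(\<Sum>k<l. chi (g * int k)) = S"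
    unfolding S_def
    using l_gt_1 cong_mult_l_cancel [OF g(1)] by (intro sum_residues_reindex chi_cong) auto
  hence 1: "chi g * S = S" by (simp add: S_def chi_mult sum_distrib_left)
  have "3 * S = S + chi g * S + chi g * (chi g * S)" unfolding 1 by simp
  also have "\<dots> = (1 + chi g + chi g * chi g) * S" by (simp add: algebra_simps)
  finally have "3 * S = 0" by (simp add: *)
  moreover have "(3::eis) = Eis 3 0" using of_int_eis [of 3] by simp
  ultimately have "S = 0" by (cases S) (simp add: zero_eis_def)
  thus ?thesis by (simp add: S_def)
qed

lemma chi_square_sum: "(\<Sum>k<l. chi (int k) ^ 2) = 0"
proof -
  have "(\<Sum>k<l. chi (int k) ^ 2) = conj_eis (\<Sum>k<l. chi (int k))"
    by (simp add: conj_eis_sum chi_conj)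
  thus ?thesis by (simp add: chi_sum)
qed

definition J :: eis where "J = (\<Sum>a<l. chi (int a) * chi (1 - int a))"

text \<open>For \<open>c\<close> prime to \<open>l\<close> the substitution of \<open>c * a\<close>
  for \<open>a\<close> pulls out \<open>chi c ^ 2\<close>. For \<open>c\<close> divisible by
  \<open>l\<close>, \<open>chi (- a) = chi a\<close> turns the sum into that of the squares, which
  vanishes.\<close>

lemma chi_conv: "(\<Sum>a<l. chi (int a) * chi (c - int a)) = J * chi c ^ 2"
proof (cases "int l dvd c")
  case True
  have "chi (c - int a) = chi (int a)" for a
  proof -
    have "chi (c - int a) = chi (- int a)" using True by (intro chi_cong) (simp add: cong_iff_dvd_diff)
    thus ?thesis by simp
  qed
  hence "(\<Sum>a<l. chi (int a) * chi (c - int a)) = (\<Sum>a<l. chi (int a) ^ 2)"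
    by (simp add: power2_eq_square)
  also have "\<dots> = 0" by (rule chi_square_sum)
  also have "0 = J * chi c ^ 2" using True by (simp add: chi_eq_0_iff [THEN iffD2])
  finally show ?thesis .
next
  case False
  have "(\<Sum>a<l. chi (int a) * chi (c - int a)) = (\<Sum>a<l. chi (c * int a) * chi (c - c * int a))"
    using l_gt_1 cong_mult_l_cancel [OF False]
    by (intro sum_residues_reindex [of l "\<lambda>a. chi a * chi (c - a)", symmetric] arg_cong2 [of _ _ _ _ "(*)"] chi_cong cong_diff) auto
  also have "\<dots> = (\<Sum>a<l. chi c ^ 2 * (chi (int a) * chi (1 - int a)))"
  proof (rule sum.cong [OF refl])
    fix a
    have "c - c * int a = c * (1 - int a)" by (simp add: algebra_simps)
    thus "chi (c * int a) * chi (c - c * int a) = chi c ^ 2 * (chi (int a) * chi (1 - int a))"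
      by (simp only: chi_mult) (simp add: algebra_simps power2_eq_square)
  qed
  finally show ?thesis by (simp add: J_def sum_distrib_left mult.commute)
qed

lemma chi_conv2: "(\<Sum>a<l. chi (int a) ^ 2 * chi (c - int a) ^ 2) = conj_eis J * chi c"
proof -
  have "(\<Sum>a<l. chi (int a) ^ 2 * chi (c - int a) ^ 2)
      = conj_eis (\<Sum>a<l. chi (int a) * chi (c - int a))"
    by (simp add: conj_eis_sum conj_eis_mult chi_conj)
  also have "\<dots> = conj_eis J * chi c ^ 4"
    by (simp add: chi_conv conj_eis_mult conj_eis_power chi_conj power_mult [symmetric])
  finally show ?thesis by (simp add: chi_power4)
qed

lemma chi_cube: "chi m ^ 3 = (if int l dvd m then 0 else 1)"
  using omega_powers_cube [OF chi_omega] by (auto simp: chi_eq_0_iff [THEN iffD2])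

text \<open>At multiples of \<open>l\<close> the sum counts the nonzero residues. Elsewhere
  rescaling shows it to be a constant \<open>K\<close>. The total over all \<open>c\<close> is zero
  because the squares of the character sum to zero, which forces \<open>K = - 1\<close>.\<close>

lemma chi_conv12:
  "(\<Sum>a<l. chi (int a) * chi (c - int a) ^ 2) = (if int l dvd c then of_nat l else 0) - 1"
proof -
  define K where "K = (\<Sum>a<l. chi (int a) * chi (1 - int a) ^ 2)"
  define V where "V c = (\<Sum>a<l. chi (int a) * chi (c - int a) ^ 2)" for c
  have V0: "V c = of_nat l - 1" if "int l dvd c" for c
  proof -
    have "chi (c - int a) = chi (int a)" for a
    proof -
      have "chi (c - int a) = chi (- int a)" using that by (intro chi_cong) (simp add: cong_iff_dvd_diff)
      thus ?thesis by simp
    qed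
    hence "V c = (\<Sum>a<l. chi (int a) ^ 3)"
      by (simp add: V_def power2_eq_square power3_eq_cube mult.assoc)
    also have "\<dots> = (\<Sum>a<l. 1 - (if a = 0 then 1 else 0))"
      by (intro sum.cong) (auto simp: chi_cube int_dvd_int_iff dest: dvd_imp_le)
    also have "\<dots> = of_nat l - 1"
      using l_gt_1 by (simp add: sum_subtractf)
    finally show ?thesis .
  qed
  have V1: "V c = K" if "\<not> int l dvd c" for c
  proof -
    have "V c = (\<Sum>a<l. chi (c * int a) * chi (c - c * int a) ^ 2)"
      unfolding V_def using l_gt_1 cong_mult_l_cancel [OF that]
      by (intro sum_residues_reindex [of l "\<lambda>a. chi a * chi (c - a) ^ 2", symmetric]
          arg_cong2 [of _ _ _ _ "(*)"] arg_cong2 [of _ _ _ _ "(^)"] chi_cong cong_diff) auto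
    also have "\<dots> = (\<Sum>a<l. chi c ^ 3 * (chi (int a) * chi (1 - int a) ^ 2))"
    proof (rule sum.cong [OF refl])
      fix a
      have "c - c * int a = c * (1 - int a)" by (simp add: algebra_simps)
      thus "chi (c * int a) * chi (c - c * int a) ^ 2 = chi c ^ 3 * (chi (int a) * chi (1 - int a) ^ 2)"
        by (simp only: chi_mult) (simp add: algebra_simps power2_eq_square power3_eq_cube)
    qed
    finally show ?thesis using that by (simp add: chi_cube K_def sum_distrib_left)
  qed
  have "(\<Sum>c<l. V (int c)) = (\<Sum>a<l. \<Sum>c<l. chi (int a) * chi (int c - int a) ^ 2)"
    unfolding V_def by (rule sum.swap)
  also have "\<dots> = (\<Sum>a<l. chi (int a) * (\<Sum>c<l. chi (int c - int a) ^ 2))"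
    by (simp add: sum_distrib_left)
  also have "\<dots> = 0"
  proof (intro sum.neutral ballI)
    fix a
    have "(\<Sum>c<l. chi (int c - int a) ^ 2) = (\<Sum>c<l. chi (int c) ^ 2)"
      using l_gt_1
      by (intro sum_residues_reindex [of l "\<lambda>c. chi c ^ 2"] arg_cong2 [of _ _ _ _ "(^)"] chi_cong)
         (auto simp: cong_iff_dvd_diff)
    thus "chi (int a) * (\<Sum>c<l. chi (int c - int a) ^ 2) = 0" by (simp add: chi_square_sum)
  qed
  finally have "(\<Sum>c<l. V (int c)) = 0" .
  moreover have "(\<Sum>c<l. V (int c)) = (\<Sum>c<l. K + (if c = 0 then of_nat l - 1 - K else 0))"
  proof (intro sum.cong refl)
    fix x assume "x \<in> {..<l}"
    hence "int l dvd int x \<longleftrightarrow> x = 0" by (auto simp: int_dvd_int_iff dest: dvd_imp_le)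
    thus "V (int x) = K + (if x = 0 then of_nat l - 1 - K else 0)"
      using V0 [of "int x"] V1 [of "int x"] by auto
  qed
  moreover have "\<dots> = of_nat l * K + (of_nat l - 1 - K)"
    using l_gt_1 by (simp add: sum.distrib)
  ultimately have "of_nat l * K + (of_nat l - 1 - K) = 0" by simp
  hence "(of_nat l - 1) * (K + 1) = 0" by (simp add: algebra_simps)
  moreover have "(of_nat l - 1 :: eis) = Eis (int l - 1) 0" by (simp add: of_nat_eis one_eis_def)
  ultimately have "K = - 1"
    using l_gt_1 by (cases K) (simp add: one_eis_def zero_eis_def)
  thus ?thesis using V0 [of c] V1 [of c] by (auto simp: V_def)
qed

section \<open>Gauss sums modulo X^l - 1\<close>

definition F :: "eis poly" where "F = cyc_poly l chi"

definition F2 :: "eis poly" where "F2 = cyc_poly l (\<lambda>k. chi k ^ 2)"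

text \<open>With X replaced by a primitive \<open>l\<close>-th root of unity, \<open>F\<close> and
  \<open>F2\<close> become the Gauss sums of the character and of its conjugate, and
  \<open>U\<close> becomes 0. Modulo X^l - 1 it is nonzero and has to be carried along as a
  correction term.\<close>

definition U :: "eis poly" where "U = cyc_poly l (\<lambda>k. 1)"

lemma l_pos: "l > 0"
  using l_gt_1 by simp

lemma cyc_poly_const_mult: "cyc_poly l (\<lambda>k. c * f k) = [:c:] * cyc_poly l f"
  unfolding cyc_poly_def sum_distrib_left by (simp add: smult_monom)

lemma cyc_coeff_const_mult: "cyc_coeff l ([:c:] * P) = c * cyc_coeff l P"
  by (simp add: cyc_coeff_smult)

lemma cyc_coeff_const: "cyc_coeff l [:c:] = 0"
  using l_pos by (simp add: monom_0 [symmetric] cyc_coeff_monom)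

lemma cyc_coeff_cyc_poly: "cyc_coeff l (cyc_poly l f) = f 1"
proof -
  have "cyc_coeff l (cyc_poly l f) = (\<Sum>k<l. if k = 1 then f (int k) else 0)"
    unfolding cyc_poly_def cyc_coeff_sum cyc_coeff_monom by (intro sum.cong) auto
  thus ?thesis using l_gt_1 by simp
qed

lemma F_F: "congr (cyc l) (F * F) ([:J:] * F2)"
  using cyc_poly_mult [where f = chi and g = chi, OF l_pos chi_cong]
  by (simp only: F_def F2_def chi_conv cyc_poly_const_mult)

lemma F2_F2: "congr (cyc l) (F2 * F2) ([:conj_eis J:] * F)"
  using cyc_poly_mult [where f = "\<lambda>k. chi k ^ 2" and g = "\<lambda>k. chi k ^ 2", OF l_pos chi_square_cong]
  by (simp only: F_def F2_def chi_conv2 cyc_poly_const_mult)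

lemma F_F2: "congr (cyc l) (F * F2) ([:of_nat l:] - U)"
proof -
  have "congr (cyc l) (F * F2) (cyc_poly l (\<lambda>c. (if int l dvd c then of_nat l else 0) - 1))"
    using cyc_poly_mult [where f = chi and g = "\<lambda>k. chi k ^ 2", OF l_pos chi_square_cong]
    by (simp only: F_def F2_def chi_conv12)
  also have "cyc_poly l (\<lambda>c. (if int l dvd c then of_nat l else 0) - 1)
      = (\<Sum>k<l. (if k = 0 then [:of_nat l:] else 0) - monom 1 k)"
    unfolding cyc_poly_def
    by (intro sum.cong refl)
       (auto simp: monom_0 diff_monom [symmetric] int_dvd_int_iff dest: dvd_imp_le)
  also have "\<dots> = [:of_nat l:] - U"
    using l_pos by (simp add: sum_subtractf U_def cyc_poly_def)
  finally show ?thesis .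
qed

lemma F_U: "congr (cyc l) (F * U) 0"
  using cyc_poly_mult [OF l_pos, of "\<lambda>k. 1" chi]
  by (simp add: F_def U_def chi_sum) (simp add: cyc_poly_def)

lemma U_U: "congr (cyc l) (U * U) ([:of_nat l:] * U)"
  using cyc_poly_mult [OF l_pos, of "\<lambda>k. 1 :: eis" "\<lambda>k. 1"]
    cyc_poly_const_mult [of "of_nat l :: eis" "\<lambda>k. 1"]
  by (simp add: U_def)

text \<open>The square of \<open>F * F2\<close> is computed twice: from \<open>F_F2\<close> and
  \<open>U_U\<close> as l (l - U), and from the squares of \<open>F\<close> and \<open>F2\<close> as
  J conj(J) (l - U). Comparing coefficients of X, where l - U has -1, gives the norm of
  \<open>J\<close>.\<close>

lemma J_conj: "J * conj_eis J = of_nat l"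
proof -
  have "congr (cyc l) ((F * F2) * (F * F2)) (([:of_nat l:] - U) * ([:of_nat l:] - U))"
    by (intro congr_mult F_F2)
  also have "([:of_nat l:] - U) * ([:of_nat l:] - U)
      = [:of_nat l:] * [:of_nat l:] - [:of_nat l:] * U - [:of_nat l:] * U + U * U"
    by (simp add: algebra_simps)
  also have "congr (cyc l) \<dots>
      ([:of_nat l:] * [:of_nat l:] - [:of_nat l:] * U - [:of_nat l:] * U + [:of_nat l:] * U)"
    by (intro congr_add congr_refl U_U)
  finally have 1: "congr (cyc l) ((F * F2) * (F * F2)) ([:of_nat l:] * ([:of_nat l:] - U))"
    by (simp only: diff_add_cancel right_diff_distrib)
  have "congr (cyc l) ((F * F) * (F2 * F2)) (([:J:] * F2) * ([:conj_eis J:] * F))"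
    by (intro congr_mult F_F F2_F2)
  also have "([:J:] * F2) * ([:conj_eis J:] * F) = [:J * conj_eis J:] * (F * F2)"
    by (simp add: mult_smult_left mult_smult_right mult.commute)
  also have "congr (cyc l) \<dots> ([:J * conj_eis J:] * ([:of_nat l:] - U))"
    by (intro congr_mult congr_refl F_F2)
  finally have 2: "congr (cyc l) ((F * F2) * (F * F2)) ([:J * conj_eis J:] * ([:of_nat l:] - U))"
    by (simp add: algebra_simps)
  have 3: "cyc_coeff l ([:c:] * ([:of_nat l:] - U)) = - c" for c
    by (simp only: cyc_coeff_const_mult cyc_coeff_diff cyc_coeff_const U_def cyc_coeff_cyc_poly)
       simp
  show ?thesis
    using cyc_coeff_cong_cyc [OF 1] cyc_coeff_cong_cyc [OF 2] unfolding 3 by simp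
qed

lemma F_cube: "congr (cyc l) (F ^ 3) ([:J:] * ([:of_nat l:] - U))"
proof -
  have "F ^ 3 = F * (F * F)" by (simp add: power3_eq_cube mult.assoc)
  also have "congr (cyc l) \<dots> (F * ([:J:] * F2))" by (intro congr_mult congr_refl F_F)
  also have "F * ([:J:] * F2) = [:J:] * (F * F2)" by (simp add: mult_smult_right)
  also have "congr (cyc l) \<dots> ([:J:] * ([:of_nat l:] - U))" by (intro congr_mult congr_refl F_F2)
  finally show ?thesis .
qed

text \<open>One further factor \<open>F\<close> annihilates the correction term \<open>U\<close>, so
  the powers of \<open>F\<close> from here on have a clean form.\<close>

lemma F_power_4: "congr (cyc l) (F ^ 3 * F) ([:J * of_nat l:] * F)"
proof -
  have "congr (cyc l) (F ^ 3 * F) ([:J:] * ([:of_nat l:] - U) * F)"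
    by (intro congr_mult congr_refl F_cube)
  also have "[:J:] * ([:of_nat l:] - U) * F = [:J * of_nat l:] * F - [:J:] * (F * U)"
    by (simp add: algebra_simps)
  also have "congr (cyc l) \<dots> ([:J * of_nat l:] * F - [:J:] * 0)"
    by (intro congr_diff congr_mult congr_refl F_U)
  finally show ?thesis by simp
qed

lemma F_power_1: "congr (cyc l) (F ^ (3 * k + 1)) ([:J * of_nat l:] ^ k * F)"
proof (induction k)
  case (Suc k)
  have "F ^ (3 * Suc k + 1) = F ^ 3 * F ^ (3 * k + 1)"
    by (simp only: power_add [symmetric]) simp
  also have "congr (cyc l) \<dots> (F ^ 3 * ([:J * of_nat l:] ^ k * F))"
    by (intro congr_mult congr_refl Suc)
  also have "F ^ 3 * ([:J * of_nat l:] ^ k * F) = [:J * of_nat l:] ^ k * (F ^ 3 * F)"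
    by (simp only: mult_ac)
  also have "congr (cyc l) \<dots> ([:J * of_nat l:] ^ k * ([:J * of_nat l:] * F))"
    by (intro congr_mult congr_refl F_power_4)
  finally show ?case by (simp only: power_Suc2 mult.assoc)
qed auto

lemma F_power_2: "congr (cyc l) (F ^ (3 * k + 2)) ([:J * of_nat l:] ^ k * ([:J:] * F2))"
proof -
  have "F ^ (3 * k + 2) = F ^ (3 * k + 1) * F"
    by (simp only: power_Suc2 [symmetric]) simp
  also have "congr (cyc l) \<dots> ([:J * of_nat l:] ^ k * F * F)"
    by (intro congr_mult congr_refl F_power_1)
  also have "[:J * of_nat l:] ^ k * F * F = [:J * of_nat l:] ^ k * (F * F)"
    by (simp only: mult.assoc)
  also have "congr (cyc l) \<dots> ([:J * of_nat l:] ^ k * ([:J:] * F2))"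
    by (intro congr_mult congr_refl F_F)
  finally show ?thesis .
qed

text \<open>Modulo \<open>q\<close> the power of the sum is the sum of the powers, so the exponent
  of the \<open>k\<close>-th term becomes \<open>k * q\<close>. Only the inverse of \<open>q\<close>
  modulo \<open>l\<close> contributes to the coefficient of X, and its character value is
  \<open>chi (int q) ^ 2\<close>.\<close>

lemma F_frobenius:
  assumes "prime q" "q \<noteq> l"
  shows "congr (of_nat q) (cyc_coeff l (F ^ q)) (chi (int q) ^ (2 * q))"
proof -
  have cop: "coprime q l" using assms prime_l primes_coprime by blast
  have nd: "\<not> int l dvd int q"
    using assms prime_l primes_dvd_imp_eq int_dvd_int_iff by metis
  obtain k0 where "[q * k0 = 1] (mod l)" using cong_solve_coprime_nat [OF cop] by auto
  hence "[q * (k0 mod l) = 1] (mod l)" by (simp add: cong_def mod_mult_right_eq)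
  then obtain k1 where k1: "k1 < l" "[q * k1 = 1] (mod l)" using l_pos mod_less_divisor by blast
  have iff: "(k * q) mod l = 1 \<longleftrightarrow> k = k1" if "k < l" for k
  proof
    assume "(k * q) mod l = 1"
    hence "[q * k = q * k1] (mod l)" using k1(2) l_gt_1 by (simp add: cong_def mult.commute)
    hence "[k = k1] (mod l)" using cop by (simp add: cong_mult_lcancel_nat)
    thus "k = k1" using that k1(1) by (simp add: cong_def)
  qed (use k1 l_gt_1 in \<open>simp add: cong_def mult.commute\<close>)
  have "[int q * int k1 = 1] (mod int l)"
    using k1(2) by (metis cong_int_iff of_nat_1 of_nat_mult)
  hence "chi (int q * int k1) = chi 1" by (rule chi_cong)
  hence *: "chi (int q) * chi (int k1) = 1" by (simp add: chi_mult)
  have "chi (int k1) = chi (int q) ^ 3 * chi (int k1)" using nd by (simp add: chi_cube)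
  also have "\<dots> = chi (int q) ^ 2 * (chi (int q) * chi (int k1))"
    by (simp add: power2_eq_square power3_eq_cube mult.assoc)
  finally have chi_k1: "chi (int k1) = chi (int q) ^ 2" using * by simp
  have "congr (of_nat q) (F ^ q) (\<Sum>k<l. monom (chi (int k)) k ^ q)"
    unfolding F_def cyc_poly_def by (rule freshman_sum [OF assms(1)])
  hence "congr (of_nat q) (cyc_coeff l (F ^ q)) (cyc_coeff l (\<Sum>k<l. monom (chi (int k)) k ^ q))"
    by (rule cyc_coeff_cong_of_nat)
  also have "cyc_coeff l (\<Sum>k<l. monom (chi (int k)) k ^ q)
      = (\<Sum>k<l. if k = k1 then chi (int k) ^ q else 0)"
    unfolding cyc_coeff_sum monom_power cyc_coeff_monom by (intro sum.cong refl) (simp add: iff del: One_nat_def)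
  also have "\<dots> = chi (int q) ^ (2 * q)"
    using k1(1) by (simp add: chi_k1 power_mult)
  finally show ?thesis .
qed

section \<open>Consequences of the Frobenius congruence for the Jacobi sum\<close>

lemma const_poly_power: "[:c:] ^ n = [:c ^ n:]"
  by (induction n) (auto simp: one_pCons mult.commute)

text \<open>The Frobenius congruence at 3: the coefficient of X in \<open>F ^ 3\<close> is
  \<open>- J\<close>, while the character contributes a sixth power, which is 1. This normalisation
  of \<open>J\<close> is what the descent in \<open>cubic_reciprocity\<close> preserves.\<close>

lemma J_mod_3: "3 dvd J + 1"
proof -
  have "l \<noteq> 3" using l_mod_3 by auto
  have "\<not> int l dvd 3" by (rule not_l_dvd_3)
  hence "chi 3 ^ 6 = 1" using chi_cube [of 3] power_mult [of "chi 3" 3 2] by simp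
  moreover have "cyc_coeff l (F ^ 3) = - J"
    using cyc_coeff_cong_cyc [OF F_cube]
    by (simp only: cyc_coeff_const_mult cyc_coeff_diff cyc_coeff_const U_def cyc_coeff_cyc_poly)
       simp
  ultimately have "congr 3 (- J) 1"
    using F_frobenius [of 3] \<open>l \<noteq> 3\<close> by simp
  hence "3 dvd - (J + 1)" by (simp add: congr_def)
  thus ?thesis by (simp only: dvd_minus_iff)
qed

text \<open>Writing a and b for the k-th powers of \<open>J\<close> and its conjugate, and x for the
  character value, the two evaluations of \<open>F ^ q\<close> give a^2 b = x^2 modulo
  \<open>q\<close>. Together with the conjugate relation b^2 a = x this yields a x = b x^2 without
  dividing by \<open>J\<close>.\<close>

lemma reciprocity_1:
  assumes "prime q" "q \<noteq> l" "q = 3 * k + 1"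
  shows "congr (of_nat q) (J ^ k) (chi (int q) * conj_eis J ^ k)"
proof -
  define x where "x = chi (int q)"
  define a where "a = J ^ k"
  define b where "b = conj_eis J ^ k"
  have nd: "\<not> int l dvd int q"
    using assms prime_l primes_dvd_imp_eq int_dvd_int_iff by metis
  hence x: "x \<in> omega_powers" unfolding x_def by (rule chi_omega)
  have "cyc_coeff l (F ^ q) = (J * of_nat l) ^ k"
    using cyc_coeff_cong_cyc [OF F_power_1 [of k]]
    by (simp add: assms(3) const_poly_power cyc_coeff_smult F_def cyc_coeff_cyc_poly)
  also have "\<dots> = a * (a * b)"
    by (simp add: J_conj [symmetric] a_def b_def power_mult_distrib mult_ac)
  finally have "congr (of_nat q) (a * (a * b)) (x ^ (2 * q))"
    using F_frobenius [OF assms(1,2)] by (simp add: x_def)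
  also have "x ^ (2 * q) = x ^ 2"
  proof -
    have "(2 * q) mod 3 = 2" unfolding assms(3) by presburger
    thus ?thesis using omega_powers_mod_3 [OF x, of "2 * q"] by simp
  qed
  finally have 1: "congr (of_nat q) (a * (a * b)) (x ^ 2)" .
  have ca: "conj_eis a = b" "conj_eis b = a" by (simp_all add: a_def b_def conj_eis_power)
  have cx: "conj_eis (x ^ 2) = x"
    using omega_powers_conj [OF x] by (metis conj_eis_conj_eis)
  have 2: "congr (of_nat q) (b * (b * a)) x"
    using congr_conj_eis_nat [OF 1] cx
    by (simp add: conj_eis_mult ca)
  have "congr (of_nat q) (a * x) (a * (b * (b * a)))"
    using congr_sym [OF 2] by (intro congr_mult congr_refl)
  also have "a * (b * (b * a)) = b * (a * (a * b))" by (simp only: mult_ac)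
  also have "congr (of_nat q) \<dots> (b * x ^ 2)" by (intro congr_mult congr_refl 1)
  finally have "congr (of_nat q) (a * x * x ^ 2) (b * x ^ 2 * x ^ 2)"
    by (rule congr_mult) (rule congr_refl)
  moreover have "a * x * x ^ 2 = a * x ^ 3" "b * x ^ 2 * x ^ 2 = x * b * x ^ 3"
    by (simp_all add: power2_eq_square power3_eq_cube mult_ac)
  ultimately show ?thesis using omega_powers_cube [OF x] by (simp add: a_def b_def x_def)
qed

text \<open>The same comparison for the other residue class: now \<open>F ^ q\<close> ends in
  \<open>F2\<close>, which supplies an additional factor \<open>J\<close>, and 2q is 1 modulo 3, so
  the Frobenius side is the character value itself.\<close>

lemma reciprocity_2:
  assumes "prime q" "q \<noteq> l" "q = 3 * k + 2"
  shows "congr (of_nat q) (conj_eis J ^ (k + 1)) (chi (int q) * J ^ (k + 1))"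
proof -
  define x where "x = chi (int q)"
  define a where "a = J ^ k"
  define b where "b = conj_eis J ^ k"
  have nd: "\<not> int l dvd int q"
    using assms prime_l primes_dvd_imp_eq int_dvd_int_iff by metis
  hence x: "x \<in> omega_powers" unfolding x_def by (rule chi_omega)
  have "cyc_coeff l (F ^ q) = (J * of_nat l) ^ k * J"
    using cyc_coeff_cong_cyc [OF F_power_2 [of k]]
    by (simp add: assms(3) const_poly_power cyc_coeff_smult F2_def cyc_coeff_cyc_poly)
  also have "\<dots> = a * (a * b) * J"
    by (simp add: J_conj [symmetric] a_def b_def power_mult_distrib mult_ac)
  finally have "congr (of_nat q) (a * (a * b) * J) (x ^ (2 * q))"
    using F_frobenius [OF assms(1,2)] by (simp add: x_def)
  also have "x ^ (2 * q) = x"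
  proof -
    have "(2 * q) mod 3 = 1" unfolding assms(3) by presburger
    thus ?thesis using omega_powers_mod_3 [OF x, of "2 * q"] by simp
  qed
  finally have 1: "congr (of_nat q) (a * (a * b) * J) x" .
  have ca: "conj_eis a = b" "conj_eis b = a" by (simp_all add: a_def b_def conj_eis_power)
  have 2: "congr (of_nat q) (b * (b * a) * conj_eis J) (x ^ 2)"
    using congr_conj_eis_nat [OF 1] omega_powers_conj [OF x]
    by (simp add: conj_eis_mult ca)
  have "congr (of_nat q) (b * conj_eis J * x) (b * conj_eis J * (a * (a * b) * J))"
    using congr_sym [OF 1] by (intro congr_mult congr_refl)
  also have "b * conj_eis J * (a * (a * b) * J) = a * J * (b * (b * a) * conj_eis J)"
    by (simp only: mult_ac)
  also have "congr (of_nat q) \<dots> (a * J * x ^ 2)" by (intro congr_mult congr_refl 2)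
  finally have "congr (of_nat q) (b * conj_eis J * x * x ^ 2) (a * J * x ^ 2 * x ^ 2)"
    by (rule congr_mult) (rule congr_refl)
  moreover have "b * conj_eis J * x * x ^ 2 = conj_eis J ^ (k + 1) * x ^ 3"
    "a * J * x ^ 2 * x ^ 2 = x * J ^ (k + 1) * x ^ 3"
    by (simp_all add: power2_eq_square power3_eq_cube mult_ac a_def b_def)
  ultimately show ?thesis using omega_powers_cube [OF x] by (simp add: x_def)
qed

section \<open>The Jacobi sum lies in the prime chosen by \<open>t\<close>\<close>

lemma power_sum:
  assumes "j < l - 1"
  shows "int l dvd (\<Sum>a<l. int a ^ j)"
proof (cases "j = 0")
  case False
  obtain g where g: "\<not> int l dvd g" "\<And>j. 0 < j \<Longrightarrow> j < l - 1 \<Longrightarrow> \<not> [g ^ j = 1] (mod int l)"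
    using primitive_root by blast
  define S where "S = (\<Sum>a<l. int a ^ j)"
  have "(\<Sum>a<l. (g * int a) ^ j mod int l) = (\<Sum>a<l. int a ^ j mod int l)"
    using l_pos cong_mult_l_cancel [OF g(1)] cong_pow
    by (intro sum_residues_reindex [of l "\<lambda>a. a ^ j mod int l"]) (auto simp: cong_def [symmetric])
  hence "[(\<Sum>a<l. (g * int a) ^ j) = (\<Sum>a<l. int a ^ j)] (mod int l)"
    unfolding cong_def by (metis mod_sum_eq)
  hence "[g ^ j * S = S] (mod int l)" by (simp add: S_def sum_distrib_left power_mult_distrib)
  hence "int l dvd (g ^ j - 1) * S" by (simp add: cong_iff_dvd_diff algebra_simps)
  moreover have "\<not> int l dvd g ^ j - 1"
    using g(2) [of j] False assms by (simp add: cong_iff_dvd_diff)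
  ultimately show ?thesis using prime_int_l prime_dvd_mult_iff S_def by blast
qed simp

text \<open>Under \<open>ev\<close> the Jacobi sum becomes the sum over all residues of the
  polynomial a^e (1 - a)^e. Its degree 2e is below l - 1 = 3e, so every power sum that occurs
  vanishes modulo \<open>l\<close>.\<close>

lemma ev_J: "int l dvd ev J"
proof -
  have "[ev J = (\<Sum>a<l. int a ^ e * (1 - int a) ^ e)] (mod int l)"
    unfolding J_def ev_sum
  proof (rule cong_sum)
    fix a
    have "[ev (chi (int a) * chi (1 - int a)) = ev (chi (int a)) * ev (chi (1 - int a))] (mod int l)"
      by (rule ev_mult)
    also have "[ev (chi (int a)) * ev (chi (1 - int a)) = int a ^ e * (1 - int a) ^ e] (mod int l)"
      by (intro cong_mult ev_chi)
    finally show "[ev (chi (int a) * chi (1 - int a)) = int a ^ e * (1 - int a) ^ e] (mod int l)" .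
  qed
  also have "(\<Sum>a<l. int a ^ e * (1 - int a) ^ e)
      = (\<Sum>a<l. \<Sum>i\<le>e. of_nat (e choose i) * (- 1) ^ i * int a ^ (e + i))"
  proof (rule sum.cong [OF refl])
    fix a
    have "(1 - int a) ^ e = (\<Sum>i\<le>e. of_nat (e choose i) * (- int a) ^ i)"
      using binomial_ring [of "- int a" 1 e] by simp
    thus "int a ^ e * (1 - int a) ^ e
        = (\<Sum>i\<le>e. of_nat (e choose i) * (- 1) ^ i * int a ^ (e + i))"
      by (simp add: sum_distrib_left power_minus [of "int a"] power_add mult_ac)
  qed
  also have "\<dots> = (\<Sum>i\<le>e. \<Sum>a<l. of_nat (e choose i) * (- 1) ^ i * int a ^ (e + i))"
    by (rule sum.swap)
  also have "\<dots> = (\<Sum>i\<le>e. of_nat (e choose i) * (- 1) ^ i * (\<Sum>a<l. int a ^ (e + i)))"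
    by (simp add: sum_distrib_left)
  finally have "[ev J = (\<Sum>i\<le>e. of_nat (e choose i) * (- 1) ^ i * (\<Sum>a<l. int a ^ (e + i)))] (mod int l)" .
  moreover have "int l dvd (\<Sum>i\<le>e. of_nat (e choose i) * (- 1) ^ i * (\<Sum>a<l. int a ^ (e + i)))"
  proof (rule dvd_sum)
    fix i assume "i \<in> {..e}"
    hence "e + i \<le> 2 * e" by simp
    hence "e + i < l - 1" using l_eq e_pos by linarith
    thus "int l dvd of_nat (e choose i) * (- 1) ^ i * (\<Sum>a<l. int a ^ (e + i))"
      by (intro dvd_mult power_sum)
  qed
  ultimately show ?thesis using cong_dvd_iff by blast
qed

end

section \<open>Reciprocity between rational and Eisenstein integers\<close>

text \<open>The map \<open>\<chi>\<close> is the symbol \<open>m \<mapsto> (m/\<gamma>)\<close>, and the last clause is the reciprocity law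
  \<open>(q/\<gamma>) = (\<gamma>/q)\<close>: modulo \<open>q\<close>, the symbol \<open>(\<gamma>/q)\<close> is the power of \<open>\<gamma>\<close> over its conjugate with
  exponent \<open>(q - 1) / 3\<close> or \<open>- (q + 1) / 3\<close>.\<close>

definition cubic_symbol :: "eis \<Rightarrow> (int \<Rightarrow> eis) \<Rightarrow> bool" where
  "cubic_symbol \<gamma> \<chi> \<longleftrightarrow>
     (\<forall>m n. \<chi> (m * n) = \<chi> m * \<chi> n) \<and>
     (\<forall>m n. [m = n] (mod nrm \<gamma>) \<longrightarrow> \<chi> m = \<chi> n) \<and>
     (\<forall>m. coprime m (nrm \<gamma>) \<longrightarrow> \<chi> m \<in> omega_powers) \<and>
     (\<forall>q k. prime q \<longrightarrow> \<not> int q dvd nrm \<gamma> \<longrightarrow>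
        (q = 3 * k + 1 \<longrightarrow> congr (of_nat q) (\<gamma> ^ k) (\<chi> (int q) * conj_eis \<gamma> ^ k)) \<and>
        (q = 3 * k + 2 \<longrightarrow> congr (of_nat q) (conj_eis \<gamma> ^ (k + 1)) (\<chi> (int q) * \<gamma> ^ (k + 1))))"

lemma cubic_symbolD:
  assumes "cubic_symbol \<gamma> \<chi>"
  shows "\<chi> (m * n) = \<chi> m * \<chi> n"
    and "[m = n] (mod nrm \<gamma>) \<Longrightarrow> \<chi> m = \<chi> n"
    and "coprime m (nrm \<gamma>) \<Longrightarrow> \<chi> m \<in> omega_powers"
    and "prime q \<Longrightarrow> \<not> int q dvd nrm \<gamma> \<Longrightarrow> q = 3 * k + 1 \<Longrightarrow>
           congr (of_nat q) (\<gamma> ^ k) (\<chi> (int q) * conj_eis \<gamma> ^ k)"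
    and "prime q \<Longrightarrow> \<not> int q dvd nrm \<gamma> \<Longrightarrow> q = 3 * k + 2 \<Longrightarrow>
           congr (of_nat q) (conj_eis \<gamma> ^ (k + 1)) (\<chi> (int q) * \<gamma> ^ (k + 1))"
  using assms unfolding cubic_symbol_def by blast+

text \<open>All clauses are multiplicative in the Eisenstein integer, so a symbol for a product can
  be assembled from symbols of Jacobi sums.\<close>

lemma cubic_symbol_mult:
  assumes "cubic_symbol \<gamma> \<chi>" "cubic_symbol \<delta> \<psi>"
  shows "cubic_symbol (\<gamma> * \<delta>) (\<lambda>m. \<chi> m * \<psi> m)"
  unfolding cubic_symbol_def nrm_mult
proof (intro conjI allI impI)
  fix m n
  show "\<chi> (m * n) * \<psi> (m * n) = \<chi> m * \<psi> m * (\<chi> n * \<psi> n)"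
    by (simp add: cubic_symbolD(1) [OF assms(1)] cubic_symbolD(1) [OF assms(2)] mult_ac)
next
  fix m n assume "[m = n] (mod nrm \<gamma> * nrm \<delta>)"
  hence "[m = n] (mod nrm \<gamma>)" "[m = n] (mod nrm \<delta>)"
    by (auto intro: cong_dvd_modulus)
  thus "\<chi> m * \<psi> m = \<chi> n * \<psi> n"
    using cubic_symbolD(2) [OF assms(1)] cubic_symbolD(2) [OF assms(2)] by metis
next
  fix m assume "coprime m (nrm \<gamma> * nrm \<delta>)"
  thus "\<chi> m * \<psi> m \<in> omega_powers"
    using cubic_symbolD(3) [OF assms(1)] cubic_symbolD(3) [OF assms(2)]
    by (auto intro: omega_powers_mult)
next
  fix q k :: nat assume q: "prime q" "\<not> int q dvd nrm \<gamma> * nrm \<delta>" "q = 3 * k + 1"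
  hence "\<not> int q dvd nrm \<gamma>" "\<not> int q dvd nrm \<delta>" by auto
  from congr_mult [OF cubic_symbolD(4) [OF assms(1) q(1) this(1) q(3)]
      cubic_symbolD(4) [OF assms(2) q(1) this(2) q(3)]]
  show "congr (of_nat q) ((\<gamma> * \<delta>) ^ k)
      (\<chi> (int q) * \<psi> (int q) * conj_eis (\<gamma> * \<delta>) ^ k)"
    by (simp add: power_mult_distrib conj_eis_mult mult_ac)
next
  fix q k :: nat assume q: "prime q" "\<not> int q dvd nrm \<gamma> * nrm \<delta>" "q = 3 * k + 2"
  hence "\<not> int q dvd nrm \<gamma>" "\<not> int q dvd nrm \<delta>" by auto
  from congr_mult [OF cubic_symbolD(5) [OF assms(1) q(1) this(1) q(3)]
      cubic_symbolD(5) [OF assms(2) q(1) this(2) q(3)]]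
  show "congr (of_nat q) (conj_eis (\<gamma> * \<delta>) ^ (k + 1))
      (\<chi> (int q) * \<psi> (int q) * (\<gamma> * \<delta>) ^ (k + 1))"
    by (simp add: power_mult_distrib conj_eis_mult mult_ac)
qed

lemma (in cubic_character) nrm_J: "nrm J = int l"
proof -
  have "(of_int (nrm J) :: eis) = of_nat l" using J_conj mult_conj_eis by metis
  thus ?thesis by (simp add: of_int_eis of_nat_eis)
qed

lemma (in cubic_character) cubic_symbol_J: "cubic_symbol J chi"
  unfolding cubic_symbol_def nrm_J
proof (intro conjI allI impI)
  fix m assume "coprime m (int l)"
  thus "chi m \<in> omega_powers"
    using prime_int_l by (intro chi_omega) (metis coprime_absorb_right not_prime_unit)
next
  fix q k :: nat assume q: "prime q" "\<not> int q dvd int l" "q = 3 * k + 1"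
  thus "congr (of_nat q) (J ^ k) (chi (int q) * conj_eis J ^ k)"
    by (intro reciprocity_1) auto
next
  fix q k :: nat assume q: "prime q" "\<not> int q dvd int l" "q = 3 * k + 2"
  thus "congr (of_nat q) (conj_eis J ^ (k + 1)) (chi (int q) * J ^ (k + 1))"
    by (intro reciprocity_2) auto
qed (simp_all add: chi_mult chi_cong)

text \<open>The cube of \<open>t\<close> is 1 modulo \<open>l\<close>. If l = 3k + 2, then t^(l-1) =
  t, so Fermat gives t = 1 and \<open>l\<close> divides 3.\<close>

lemma mod_3_eq_1_of_root:
  fixes t :: int
  assumes "prime l" "l \<noteq> 3" "int l dvd t\<^sup>2 + t + 1"
  shows "l mod 3 = 1"
proof (rule ccontr)
  assume "l mod 3 \<noteq> 1"
  have "prime (int l)" using assms(1) by simp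
  have "l mod 3 \<noteq> 0"
    using assms(1,2) primes_dvd_imp_eq [of 3 l] by (auto simp: mod_eq_0_iff_dvd)
  with \<open>l mod 3 \<noteq> 1\<close> have "l mod 3 = 2" by presburger
  then obtain k where k: "l = 3 * k + 2" using mult_div_mod_eq [of 3 l] by metis
  have "\<not> int l dvd t"
  proof
    assume "int l dvd t"
    hence "int l dvd (t\<^sup>2 + t + 1) - t * (t + 1)" using assms(3) by (intro dvd_diff dvd_mult2)
    thus False using prime_gt_1_nat [OF assms(1)] by (simp add: algebra_simps power2_eq_square)
  qed
  hence "[t ^ (l - 1) = 1] (mod int l)" by (rule fermat_theorem_int [OF assms(1)])
  moreover have "[t ^ 3 = 1] (mod int l)"
  proof -
    have "t ^ 3 - 1 = (t - 1) * (t\<^sup>2 + t + 1)"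
      by (simp add: algebra_simps power2_eq_square power3_eq_cube)
    thus ?thesis using assms(3) by (simp add: cong_iff_dvd_diff)
  qed
  hence "[(t ^ 3) ^ k * t = 1 ^ k * t] (mod int l)" by (intro cong_mult cong_pow cong_refl)
  hence "[t ^ (l - 1) = t] (mod int l)"
    by (simp add: k power_mult [symmetric] mult.commute)
  ultimately have "[t = 1] (mod int l)" using cong_trans cong_sym by blast
  hence "int l dvd t - 1" by (simp only: cong_iff_dvd_diff)
  hence "int l dvd (t\<^sup>2 + t + 1) - (t - 1) * (t + 2)"
    by (intro dvd_diff [OF assms(3)] dvd_mult2)
  hence "int l dvd int 3" by (simp add: algebra_simps power2_eq_square)
  hence "l dvd 3" by (simp only: int_dvd_int_iff)
  hence "l \<le> 3" by (rule dvd_imp_le) simp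
  hence "l = 2" using prime_ge_2_nat [OF assms(1)] assms(2) by linarith
  thus False using \<open>l dvd 3\<close> by simp
qed

text \<open>Induction on the norm. Coprime coordinates make each prime divisor of the norm the norm
  of a Jacobi sum, which is split off. The divisibility by 3 persists in the cofactor because Jacobi
  sums are -1 modulo 3.\<close>

lemma cubic_reciprocity:
  assumes "coprime c d" "3 dvd d"
  shows "\<exists>\<chi>. cubic_symbol (Eis c d) \<chi>"
  using assms
proof (induction "nat (nrm (Eis c d))" arbitrary: c d rule: less_induct)
  case less
  define N where "N = nrm (Eis c d)"
  have N_nonneg: "N \<ge> 0" unfolding N_def by (rule nrm_nonneg)
  have N_eq: "N = c\<^sup>2 - c * d + d\<^sup>2" by (simp add: N_def)
  have c3: "\<not> 3 dvd c" using less.prems coprime_common_divisor [of c d 3] by auto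
  have N3: "\<not> 3 dvd N"
  proof
    assume "3 dvd N"
    hence "3 dvd N + d * (c - d)" using less.prems(2) by auto
    also have "N + d * (c - d) = c\<^sup>2" by (simp add: N_eq algebra_simps power2_eq_square)
    finally show False using c3 prime_dvd_power [of "3::int"] by auto
  qed
  show ?case
  proof (cases "N = 1")
    case True
    \<comment> \<open>Norm 1 together with \<open>3 dvd d\<close> leaves only 1 and -1, for which
      the constant symbol works.\<close>
    have "4 = (2 * c - d)\<^sup>2 + 3 * d\<^sup>2"
      using True by (simp add: N_eq algebra_simps power2_eq_square)
    hence "3 * d\<^sup>2 \<le> 4" using zero_le_power2 [of "2 * c - d"] by linarith
    moreover have "9 \<le> d\<^sup>2" if "d \<noteq> 0"
    proof -
      have "\<bar>d\<bar> \<ge> 3" using less.prems(2) that by (auto dest: dvd_imp_le_int)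
      thus ?thesis using power_mono [of 3 "\<bar>d\<bar>" 2] by simp
    qed
    ultimately have "d = 0" by fastforce
    moreover have "1 \<in> omega_powers" by (simp add: omega_powers_def)
    ultimately have "cubic_symbol (Eis c d) (\<lambda>_. 1)"
      by (simp add: cubic_symbol_def)
    thus ?thesis by blast
  next
    case False
    have "N \<noteq> 0" using N3 by auto
    obtain l where l: "prime l" "l dvd nat N"
      using prime_factor_nat [of "nat N"] False by fastforce
    have pl: "prime (int l)" using l by simp
    have lN: "int l dvd N" using l(2) N_nonneg by (metis int_dvd_int_iff int_nat_eq)
    have l3: "l \<noteq> 3" using lN N3 by auto
    have ld: "\<not> int l dvd d"
    proof
      assume d: "int l dvd d"
      hence "int l dvd N + d * (c - d)" using lN by auto
      also have "N + d * (c - d) = c\<^sup>2" by (simp add: N_eq algebra_simps power2_eq_square)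
      finally have "int l dvd c" using pl prime_dvd_power by blast
      hence "is_unit (int l)" using d less.prems(1) coprime_common_divisor by blast
      thus False using pl not_prime_unit by blast
    qed
    hence "coprime d (int l)" using pl prime_imp_coprime coprime_commute by blast
    then obtain s where s: "[d * s = 1] (mod int l)" using cong_solve_coprime_int by blast
    \<comment> \<open>This is -c/d modulo \<open>l\<close>, the image of \<omega> under the
      reduction that kills \<open>Eis c d\<close>. Hence \<open>Eis c d\<close> and the Jacobi sum
      attached to this root lie in the same prime above \<open>l\<close>.\<close>
    define t where "t = - c * s"
    have "d * t + c = - c * (d * s - 1)" by (simp add: t_def algebra_simps)
    hence t: "int l dvd d * t + c" using s by (simp add: cong_iff_dvd_diff)
    have "int l dvd N + (d * t + c) * (d * t - c + d)" using lN t by auto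
    also have "N + (d * t + c) * (d * t - c + d) = d * (d * (t\<^sup>2 + t + 1))"
      by (simp add: N_eq algebra_simps power2_eq_square)
    finally have root: "int l dvd t\<^sup>2 + t + 1" using ld pl prime_dvd_mult_iff by blast
    interpret C: cubic_character l t
      using l(1) root mod_3_eq_1_of_root [OF l(1) l3 root] by unfold_locales
    obtain u v where J: "C.J = Eis u v" by (cases C.J)
    have "of_int 3 dvd Eis (u + 1) v" using C.J_mod_3 by (simp add: J one_eis_def)
    hence uv3: "3 dvd u + 1" "3 dvd v" by (simp_all only: of_int_dvd_Eis_iff)
    have uvt: "int l dvd u + v * t" using C.ev_J by (simp add: J)
    \<comment> \<open>Division by \<open>J\<close> is multiplication by its conjugate followed by
      division by \<open>l\<close>. The two coordinates of the product are therefore shown to be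
      multiples of \<open>l\<close>.\<close>
    have "int l dvd (u - v) * (d * t + c) - d * t * (u + v * t) + d * v * (t\<^sup>2 + t + 1)"
      by (rule dvd_add [OF dvd_diff [OF dvd_mult [OF t] dvd_mult [OF uvt]] dvd_mult [OF root]])
    also have "(u - v) * (d * t + c) - d * t * (u + v * t) + d * v * (t\<^sup>2 + t + 1)
        = c * (u - v) + d * v" by (simp add: algebra_simps power2_eq_square)
    finally obtain c1 where c1: "c * (u - v) + d * v = int l * c1" by (elim dvdE)
    have "int l dvd d * (u + v * t) - v * (d * t + c)"
      by (rule dvd_diff [OF dvd_mult [OF uvt] dvd_mult [OF t]])
    also have "d * (u + v * t) - v * (d * t + c) = d * u - c * v" by (simp add: algebra_simps)
    finally obtain d1 where d1: "d * u - c * v = int l * d1" by (elim dvdE)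
    have eq: "Eis c d * conj_eis C.J = of_nat l * Eis c1 d1"
      using c1 d1 by (simp add: J of_nat_eis algebra_simps)
    have "of_nat l * Eis c d = C.J * conj_eis C.J * Eis c d" by (simp only: C.J_conj)
    also have "\<dots> = Eis c d * conj_eis C.J * C.J" by (simp only: mult_ac)
    also have "\<dots> = of_nat l * (C.J * Eis c1 d1)" unfolding eq by (simp only: mult_ac)
    finally have "of_nat l * Eis c d = of_nat l * (C.J * Eis c1 d1)" .
    hence split: "Eis c d = C.J * Eis c1 d1"
      using C.l_gt_1 by (cases "C.J * Eis c1 d1") (simp add: of_nat_eis)
    have nrm_split: "N = int l * nrm (Eis c1 d1)"
      unfolding N_def split nrm_mult C.nrm_J ..
    have "coprime c1 d1"
    proof (rule coprimeI)
      fix z assume "z dvd c1" "z dvd d1"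
      hence "of_int z dvd Eis c1 d1" by (simp add: of_int_dvd_Eis_iff)
      hence "of_int z dvd Eis c d" unfolding split by simp
      hence "z dvd c" "z dvd d" by (simp_all only: of_int_dvd_Eis_iff)
      thus "is_unit z" using less.prems(1) coprime_common_divisor by blast
    qed
    \<comment> \<open>Modulo 3 the factor \<open>J\<close> is -1, so \<open>d\<close> and
      \<open>- d1\<close> agree there.\<close>
    moreover have "3 dvd d1"
    proof -
      have "d = u * d1 + v * c1 - v * d1" using split by (simp add: J)
      hence "d1 = (u + 1) * d1 - d + v * c1 - v * d1" by (simp add: algebra_simps)
      moreover have "3 dvd (u + 1) * d1 - d + v * c1 - v * d1"
        by (rule dvd_diff [OF dvd_add [OF dvd_diff [OF dvd_mult2 [OF uv3(1)] less.prems(2)]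
              dvd_mult2 [OF uv3(2)]] dvd_mult2 [OF uv3(2)]])
      ultimately show ?thesis by simp
    qed
    moreover have "nat (nrm (Eis c1 d1)) < nat (nrm (Eis c d))"
    proof -
      have "nrm (Eis c1 d1) > 0"
        using \<open>N \<noteq> 0\<close> nrm_split nrm_nonneg [of "Eis c1 d1"] by (metis less_le mult_zero_right)
      hence "nrm (Eis c1 d1) < N" unfolding nrm_split using C.l_gt_1 by simp
      thus ?thesis using \<open>nrm (Eis c1 d1) > 0\<close> by (simp only: N_def zless_nat_conj) simp
    qed
    ultimately obtain \<psi> where "cubic_symbol (Eis c1 d1) \<psi>" using less.hyps by blast
    with C.cubic_symbol_J have "cubic_symbol (C.J * Eis c1 d1) (\<lambda>m. C.chi m * \<psi> m)"
      by (rule cubic_symbol_mult)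
    thus ?thesis unfolding split by blast
  qed
qed

section \<open>The binomial sum\<close>

text \<open>The ratio of consecutive coefficients with denominators cleared; for k = n both sides
  are zero.\<close>

lemma binomial_double_Suc:
  assumes "k \<le> n"
  shows "int ((n + Suc k) choose (2 * Suc k)) * (2 * int k + 2) * (2 * int k + 1)
       = int ((n + k) choose (2 * k)) * (int n + int k + 1) * (int n - int k)"
proof (cases "k = n")
  case False
  hence "k < n" using assms by simp
  have 1: "Suc (2 * k + 1) * (Suc (n + k) choose Suc (2 * k + 1)) = Suc (n + k) * ((n + k) choose (2 * k + 1))"
    by (rule Suc_times_binomial)
  have "Suc (2 * k) * (Suc (2 * k + (n - k - 1)) choose Suc (2 * k))
      = Suc (n - k - 1) * (Suc (2 * k + (n - k - 1)) choose (2 * k))"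
    by (rule Suc_times_binomial_add)
  moreover have "Suc (2 * k + (n - k - 1)) = n + k" "Suc (n - k - 1) = n - k" using \<open>k < n\<close> by auto
  ultimately have "Suc (2 * k) * ((n + k) choose Suc (2 * k)) = (n - k) * ((n + k) choose (2 * k))"
    by (simp only:)
  hence 2: "(2 * k + 1) * ((n + k) choose (2 * k + 1)) = (n - k) * ((n + k) choose (2 * k))"
    by (simp only: Suc_eq_plus1)
  have "((n + Suc k) choose (2 * Suc k)) * (2 * k + 2) * (2 * k + 1)
      = (2 * k + 1) * (Suc (2 * k + 1) * (Suc (n + k) choose Suc (2 * k + 1)))"
    by (simp add: algebra_simps)
  also have "\<dots> = Suc (n + k) * ((2 * k + 1) * ((n + k) choose (2 * k + 1)))"
    unfolding 1 by (simp only: mult_ac)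
  also have "\<dots> = ((n + k) choose (2 * k)) * (n + k + 1) * (n - k)"
    unfolding 2 by (simp only: Suc_eq_plus1 mult_ac)
  finally have "int (((n + Suc k) choose (2 * Suc k)) * (2 * k + 2) * (2 * k + 1))
      = int (((n + k) choose (2 * k)) * (n + k + 1) * (n - k))" by (simp only:)
  moreover have "int (n - k) = int n - int k" using \<open>k < n\<close> by simp
  ultimately show ?thesis by (simp only: of_nat_mult of_nat_add of_nat_numeral of_nat_1)
qed (simp add: binomial_eq_0)

text \<open>Induction on k by comparing ratios. As 3n = -r modulo \<open>p\<close>, the product -27
  (n+k+1)(n-k) becomes 3 (3k+3-r)(3k+r), which is 3 (3k+1)(3k+2) for both values of r. Keeping the
  factorials avoids division.\<close>

lemma choose_cong_aux:
  assumes p: "p = 3 * n + r" "r = 1 \<or> r = 2" and "k \<le> n"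
  shows "[(- 27) ^ k * int ((n + k) choose (2 * k)) * fact k * fact (2 * k) = fact (3 * k)] (mod int p)"
  using \<open>k \<le> n\<close>
proof (induction k)
  case (Suc k)
  define X :: int where "X = (- 27) ^ k * int ((n + k) choose (2 * k)) * fact k * fact (2 * k)"
  have IH: "[X = fact (3 * k)] (mod int p)" unfolding X_def using Suc by auto
  have "(- 27) ^ Suc k * int ((n + Suc k) choose (2 * Suc k)) * fact (Suc k) * fact (2 * Suc k)
      = (- 27) ^ Suc k * (int k + 1) * fact k * fact (2 * k)
        * (int ((n + Suc k) choose (2 * Suc k)) * (2 * int k + 2) * (2 * int k + 1))"
    by (simp add: algebra_simps)
  also have "\<dots> = (- 27) ^ Suc k * (int k + 1) * fact k * fact (2 * k)
        * (int ((n + k) choose (2 * k)) * (int n + int k + 1) * (int n - int k))"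
    using binomial_double_Suc [of k n] Suc.prems by simp
  also have "\<dots> = X * (- 27 * (int k + 1) * (int n + int k + 1) * (int n - int k))"
    by (simp only: X_def power_Suc mult_ac)
  also have "[\<dots> = fact (3 * k) * (3 * (int k + 1) * (3 * int k + 1) * (3 * int k + 2))] (mod int p)"
  proof (rule cong_mult [OF IH])
    have "- 27 * (int k + 1) * (int n + int k + 1) * (int n - int k)
          - 3 * (int k + 1) * (3 * int k + 1) * (3 * int k + 2)
        = - 3 * (int k + 1) * int p * (3 * int n + 3 - int r)"
      using p by (auto simp: algebra_simps)
    thus "[- 27 * (int k + 1) * (int n + int k + 1) * (int n - int k)
        = 3 * (int k + 1) * (3 * int k + 1) * (3 * int k + 2)] (mod int p)"
      by (simp add: cong_iff_dvd_diff)
  qed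
  also have "fact (3 * k) * (3 * (int k + 1) * (3 * int k + 1) * (3 * int k + 2)) = fact (3 * Suc k)"
    by (simp add: algebra_simps numeral_3_eq_3)
  finally show ?case .
qed simp

lemma choose_3k_k_cong:
  assumes "prime p" "p > 3" "k \<le> p div 3"
  shows "[int ((3 * k) choose k) = int ((p div 3 + k) choose (2 * k)) * (- 27) ^ k] (mod int p)"
proof -
  define n where "n = p div 3"
  have "p mod 3 \<noteq> 0"
    using assms(1,2) primes_dvd_imp_eq [of 3 p] by (auto simp: mod_eq_0_iff_dvd)
  hence "p = 3 * n + p mod 3" "p mod 3 = 1 \<or> p mod 3 = 2" by (auto simp: n_def)
  note * = choose_cong_aux [OF this, of k]
  have "k \<le> 3 * k" by simp
  hence "fact k * fact (3 * k - k) * ((3 * k) choose k) = (fact (3 * k) :: nat)"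
    by (rule binomial_fact_lemma)
  moreover have "3 * k - k = 2 * k" by simp
  ultimately have "int (fact k * fact (2 * k) * ((3 * k) choose k)) = int (fact (3 * k))"
    by (simp only:)
  hence "fact (3 * k) = (fact k * fact (2 * k)) * int ((3 * k) choose k)" by simp
  with * assms(3) have "[(fact k * fact (2 * k)) * int ((3 * k) choose k)
      = (fact k * fact (2 * k)) * (int ((n + k) choose (2 * k)) * (- 27) ^ k)] (mod int p)"
    by (simp add: n_def cong_sym_eq mult_ac)
  moreover have "coprime (fact k * fact (2 * k) :: int) (int p)"
  proof -
    have "\<not> p dvd fact k" "\<not> p dvd fact (2 * k)"
      using assms prime_dvd_fact_iff [OF assms(1)] by auto
    hence "coprime (fact k * fact (2 * k)) p"
      using assms(1) prime_imp_coprime coprime_commute by (metis coprime_mult_left_iff)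
    hence "coprime (int (fact k * fact (2 * k))) (int p)" by (simp only: coprime_int_iff)
    thus ?thesis by simp
  qed
  ultimately show ?thesis unfolding n_def using cong_mult_lcancel by blast
qed

text \<open>A division-free closed form of the Morgan-Voyce polynomials at u = (x - y)^2 /
  (xy).\<close>

lemma double_binomial_sum:
  fixes u x y :: "'a::comm_ring_1" and n :: nat
  assumes "congr m (u * (x * y)) ((x - y)\<^sup>2)"
  shows "congr m ((\<Sum>k\<le>n. of_nat ((n + k) choose (2 * k)) * u ^ k) * (x * y) ^ n * (x + y))
           (x ^ (2 * n + 1) + y ^ (2 * n + 1))"
proof -
  \<comment> \<open>The companion \<open>B\<close> makes the recurrence first order: the two closed
    forms, the sum of odd powers and the difference of even powers, are proved
    simultaneously.\<close>
  define A where "A n = (\<Sum>k\<le>n. of_nat ((n + k) choose (2 * k)) * u ^ k)" for n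
  define B where "B n = (\<Sum>k\<le>n. of_nat ((n + k + 1) choose (2 * k + 1)) * u ^ k)" for n
  have A_Suc: "A (Suc n) = A n + u * B n" for n
  proof -
    have "A (Suc n) = 1 + (\<Sum>k\<le>n. of_nat ((Suc n + Suc k) choose (2 * Suc k)) * u ^ Suc k)"
      unfolding A_def by (subst sum.atMost_Suc_shift) simp
    also have "(\<Sum>k\<le>n. of_nat ((Suc n + Suc k) choose (2 * Suc k)) * u ^ Suc k)
        = (\<Sum>k\<le>n. of_nat ((n + Suc k) choose (2 * Suc k)) * u ^ Suc k) + u * B n"
      unfolding B_def sum_distrib_left sum.distrib [symmetric]
      by (intro sum.cong refl) (simp add: algebra_simps)
    also have "1 + ((\<Sum>k\<le>n. of_nat ((n + Suc k) choose (2 * Suc k)) * u ^ Suc k) + u * B n)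
        = (\<Sum>k\<le>Suc n. of_nat ((n + k) choose (2 * k)) * u ^ k) + u * B n"
      by (subst sum.atMost_Suc_shift) simp
    also have "(\<Sum>k\<le>Suc n. of_nat ((n + k) choose (2 * k)) * u ^ k) = A n"
      by (simp add: A_def binomial_eq_0)
    finally show ?thesis .
  qed
  have B_Suc: "B (Suc n) = A (Suc n) + B n" for n
  proof -
    have "B (Suc n) = (\<Sum>k\<le>Suc n. of_nat ((Suc n + k) choose (2 * k)) * u ^ k
        + of_nat ((n + k + 1) choose (2 * k + 1)) * u ^ k)"
      unfolding B_def by (intro sum.cong refl) (simp add: algebra_simps)
    also have "\<dots> = A (Suc n) + (\<Sum>k\<le>Suc n. of_nat ((n + k + 1) choose (2 * k + 1)) * u ^ k)"
      by (simp only: sum.distrib A_def)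
    also have "(\<Sum>k\<le>Suc n. of_nat ((n + k + 1) choose (2 * k + 1)) * u ^ k) = B n"
      by (simp add: B_def binomial_eq_0)
    finally show ?thesis .
  qed
  have "congr m (A n * (x * y) ^ n * (x + y)) (x ^ (2 * n + 1) + y ^ (2 * n + 1)) \<and>
        congr m (B n * (x * y) ^ n * (x + y) * (x - y)) (x ^ (2 * n + 2) - y ^ (2 * n + 2))"
  proof (induction n)
    case 0
    have "(x + y) * (x - y) = x\<^sup>2 - y\<^sup>2" by (simp add: algebra_simps power2_eq_square)
    thus ?case by (simp add: A_def B_def power2_eq_square)
  next
    case (Suc n)
    let ?P = "(x * y) ^ n * (x + y)"
    have "A (Suc n) * (x * y) ^ Suc n * (x + y)
        = (x * y) * (A n * (x * y) ^ n * (x + y)) + (u * (x * y)) * (B n * ?P)"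
      by (simp add: A_Suc algebra_simps)
    also have "congr m \<dots> ((x * y) * (x ^ (2 * n + 1) + y ^ (2 * n + 1)) + (x - y)\<^sup>2 * (B n * ?P))"
      using Suc assms by (intro congr_add congr_mult congr_refl) auto
    also have "(x * y) * (x ^ (2 * n + 1) + y ^ (2 * n + 1)) + (x - y)\<^sup>2 * (B n * ?P)
        = (x * y) * (x ^ (2 * n + 1) + y ^ (2 * n + 1))
          + (x - y) * (B n * (x * y) ^ n * (x + y) * (x - y))"
      by (simp add: power2_eq_square mult_ac)
    also have "congr m \<dots> ((x * y) * (x ^ (2 * n + 1) + y ^ (2 * n + 1))
          + (x - y) * (x ^ (2 * n + 2) - y ^ (2 * n + 2)))"
      using Suc by (intro congr_add [OF congr_refl] congr_mult [OF congr_refl]) auto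
    also have "(x * y) * (x ^ (2 * n + 1) + y ^ (2 * n + 1)) + (x - y) * (x ^ (2 * n + 2) - y ^ (2 * n + 2))
        = x ^ (2 * Suc n + 1) + y ^ (2 * Suc n + 1)"
      by (simp add: algebra_simps)
    finally have 1: "congr m (A (Suc n) * (x * y) ^ Suc n * (x + y))
        (x ^ (2 * Suc n + 1) + y ^ (2 * Suc n + 1))" .
    have "B (Suc n) * (x * y) ^ Suc n * (x + y) * (x - y)
        = (x * y) * (B n * (x * y) ^ n * (x + y) * (x - y))
          + (x - y) * (A (Suc n) * (x * y) ^ Suc n * (x + y))"
      by (simp add: B_Suc algebra_simps)
    also have "congr m \<dots> ((x * y) * (x ^ (2 * n + 2) - y ^ (2 * n + 2))
          + (x - y) * (x ^ (2 * Suc n + 1) + y ^ (2 * Suc n + 1)))"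
      using Suc 1 by (intro congr_add congr_mult [OF congr_refl]) auto
    also have "(x * y) * (x ^ (2 * n + 2) - y ^ (2 * n + 2))
          + (x - y) * (x ^ (2 * Suc n + 1) + y ^ (2 * Suc n + 1))
        = x ^ (2 * Suc n + 2) - y ^ (2 * Suc n + 2)"
      by (simp add: algebra_simps)
    finally show ?case using 1 by blast
  qed
  thus ?thesis by (simp add: A_def)
qed

section \<open>From the binomial sum to a trace\<close>

lemma congr_of_int_eis_iff: "congr (of_int n) (of_int a :: eis) (of_int b) \<longleftrightarrow> [a = b] (mod n)"
  by (simp only: congr_def of_int_diff [symmetric] of_int_dvd_of_int_eis cong_iff_dvd_diff)

text \<open>A rational prime may split in the Eisenstein integers, but a rational integer prime to
  it can still be cancelled in each coordinate.\<close>

lemma congr_eis_cancel: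
  assumes "prime q" "\<not> q dvd n" "congr (of_int q) (of_int n * x) (of_int n * (y::eis))"
  shows "congr (of_int q) x y"
proof -
  obtain a b where ab: "x - y = Eis a b" by (cases "x - y")
  have "of_int q dvd of_int n * (x - y)"
    using assms(3) by (simp add: congr_def right_diff_distrib)
  also have "of_int n * (x - y) = Eis (n * a) (n * b)" by (simp add: ab of_int_eis)
  finally have "q dvd n * a" "q dvd n * b" by (simp_all only: of_int_dvd_Eis_iff)
  hence "q dvd a" "q dvd b" using assms(1,2) prime_dvd_mult_iff by blast+
  thus ?thesis by (simp add: congr_def ab of_int_dvd_Eis_iff)
qed

text \<open>In terms of g = c + d \<omega> the conclusion reads S Tr(g) = Tr(\<chi>(p) g) modulo
  \<open>p\<close>. The divisibility by \<open>p\<close> says that -27 N(g) agrees with (g - conj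
  g)^2 = -3 d^2, so the closed form applies at u = -27.\<close>

lemma choose_sum_cong_trace:
  assumes p: "prime p" "p > 3" and symbol: "cubic_symbol (Eis c d) \<chi>"
    and nd: "\<not> int p dvd nrm (Eis c d)" and dvd: "int p dvd 9 * nrm (Eis c d) - d\<^sup>2"
    and z: "\<chi> (int p) * Eis c d = Eis a b"
  shows "[int (\<Sum>k = 0..p div 3. (3 * k) choose k) * (2 * c - d) = 2 * a - b] (mod int p)"
proof -
  define n where "n = p div 3"
  define g where "g = Eis c d"
  define h where "h = conj_eis g"
  define N where "N = nrm g"
  define S where "S = (\<Sum>k = 0..p div 3. (3 * k) choose k)"
  define A :: int where "A = (\<Sum>k\<le>n. int ((n + k) choose (2 * k)) * (- 27) ^ k)"
  have gh: "g * h = of_int N" unfolding h_def N_def by (rule mult_conj_eis)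
  have gh_add: "g + h = of_int (2 * c - d)" by (simp add: g_def h_def of_int_eis)
  have S_A: "[int S = A] (mod int p)"
    unfolding S_def A_def n_def of_nat_sum atLeast0AtMost
    using p by (intro cong_sum choose_3k_k_cong) auto
  have eis_27: "(27 :: eis) = Eis 27 0" using of_int_eis [of 27] by simp
  have eq: "(- 27) * (g * h) - (g - h)\<^sup>2 = of_int (- 3 * (9 * N - d\<^sup>2))"
    by (simp add: eis_27 g_def h_def N_def power2_eq_square of_int_eis algebra_simps)
  have "int p dvd - 3 * (9 * N - d\<^sup>2)" using dvd unfolding N_def g_def by (rule dvd_mult)
  hence "congr (of_int (int p)) ((- 27) * (g * h)) ((g - h)\<^sup>2)"
    unfolding congr_def eq by (simp only: of_int_dvd_of_int_eis)
  hence "congr (of_int (int p)) ((\<Sum>k\<le>n. of_nat ((n + k) choose (2 * k)) * (- 27) ^ k) * (g * h) ^ n * (g + h))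
      (g ^ (2 * n + 1) + h ^ (2 * n + 1))"
    by (rule double_binomial_sum)
  moreover have "(\<Sum>k\<le>n. of_nat ((n + k) choose (2 * k)) * (- 27) ^ k) = (of_int A :: eis)"
    by (simp add: A_def)
  ultimately have 1: "congr (of_int (int p)) (of_int A * (g * h) ^ n * (g + h))
      (g ^ (2 * n + 1) + h ^ (2 * n + 1))" by simp
  have ch: "conj_eis h = g" by (simp add: h_def)
  define w where "w = \<chi> (int p) * g"
  have "p mod 3 \<noteq> 0"
    using p primes_dvd_imp_eq [of 3 p] by (auto simp: mod_eq_0_iff_dvd)
  hence "p = 3 * n + 1 \<or> p = 3 * n + 2" unfolding n_def by presburger
  \<comment> \<open>In either residue class of \<open>p\<close>, reciprocity turns one of the two
    odd powers into N(g)^n w; conjugation handles the other.\<close>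
  hence "congr (of_int (int p)) (g ^ (2 * n + 1) + h ^ (2 * n + 1)) ((g * h) ^ n * (w + conj_eis w))"
  proof
    assume "p = 3 * n + 1"
    hence "congr (of_nat p) (g ^ n) (\<chi> (int p) * h ^ n)"
      using cubic_symbolD(4) [OF symbol p(1) nd] by (simp add: g_def h_def)
    hence "congr (of_nat p) (g ^ n * (g ^ n * g)) (\<chi> (int p) * h ^ n * (g ^ n * g))"
      by (rule congr_mult) (rule congr_refl)
    moreover have "g ^ n * (g ^ n * g) = g ^ (2 * n + 1)"
      unfolding mult_2 power_add power_one_right by (simp only: mult_ac)
    moreover have "\<chi> (int p) * h ^ n * (g ^ n * g) = (g * h) ^ n * w"
      by (simp add: w_def power_mult_distrib mult_ac)
    ultimately have 2: "congr (of_nat p) (g ^ (2 * n + 1)) ((g * h) ^ n * w)" by simp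
    from congr_conj_eis_nat [OF this]
    have "congr (of_nat p) (h ^ (2 * n + 1)) ((g * h) ^ n * conj_eis w)"
      by (simp only: conj_eis_mult conj_eis_power h_def [symmetric] ch) (simp only: mult.commute)
    from congr_add [OF 2 this] show ?thesis by (simp only: of_int_of_nat_eq distrib_left)
  next
    assume "p = 3 * n + 2"
    hence "congr (of_nat p) (h ^ (n + 1)) (\<chi> (int p) * g ^ (n + 1))"
      using cubic_symbolD(5) [OF symbol p(1) nd] by (simp only: g_def h_def)
    hence "congr (of_nat p) (h ^ (n + 1) * h ^ n) (\<chi> (int p) * g ^ (n + 1) * h ^ n)"
      by (rule congr_mult) (rule congr_refl)
    moreover have "h ^ (n + 1) * h ^ n = h ^ (2 * n + 1)"
      unfolding mult_2 power_add power_one_right by (simp only: mult_ac)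
    moreover have "\<chi> (int p) * g ^ (n + 1) * h ^ n = (g * h) ^ n * w"
      by (simp add: w_def power_mult_distrib mult_ac)
    ultimately have 2: "congr (of_nat p) (h ^ (2 * n + 1)) ((g * h) ^ n * w)" by simp
    from congr_conj_eis_nat [OF this]
    have "congr (of_nat p) (g ^ (2 * n + 1)) ((g * h) ^ n * conj_eis w)"
      by (simp only: conj_eis_mult conj_eis_power h_def [symmetric] ch) (simp only: mult.commute)
    from congr_add [OF this 2] show ?thesis
      by (simp only: of_int_of_nat_eq distrib_left add.commute)
  qed
  moreover have "w + conj_eis w = of_int (2 * a - b)"
    using z by (simp add: w_def g_def of_int_eis)
  ultimately have "congr (of_int (int p)) (of_int (N ^ n) * of_int (A * (2 * c - d)))
      (of_int (N ^ n) * (of_int (2 * a - b) :: eis))"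
    using congr_trans [OF 1] by (simp add: gh gh_add mult_ac)
  moreover have "\<not> int p dvd N ^ n"
    using nd p(1) prime_dvd_power [of "int p" N n] by (auto simp: N_def g_def)
  ultimately have "congr (of_int (int p)) (of_int (A * (2 * c - d)) :: eis) (of_int (2 * a - b))"
    using p(1) congr_eis_cancel [of "int p"] by auto
  hence "[A * (2 * c - d) = 2 * a - b] (mod int p)" by (simp only: congr_of_int_eis_iff)
  moreover have "[int S * (2 * c - d) = A * (2 * c - d)] (mod int p)"
    using S_A by (intro cong_mult cong_refl)
  ultimately show ?thesis unfolding S_def using cong_trans by blast
qed

section \<open>Forms of discriminant \<open>-207\<close>\<close>

lemma not_coprime_int_prime_factor:
  fixes a b :: int
  assumes "\<not> coprime a b"
  shows "\<exists>r. prime r \<and> r dvd a \<and> r dvd b"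
proof -
  have "\<bar>gcd a b\<bar> \<noteq> 1" using assms by (simp add: coprime_iff_gcd_eq_1)
  then obtain r where "prime r" "r dvd gcd a b" using prime_factor_int by blast
  thus ?thesis by auto
qed

lemma cubic_symbol_1:
  assumes "cubic_symbol \<gamma> \<chi>"
  shows "\<chi> 1 = 1" "\<chi> (- 1) = 1"
proof -
  have "\<chi> 1 \<in> omega_powers" by (rule cubic_symbolD(3) [OF assms]) simp
  moreover have "\<chi> 1 = \<chi> 1 * \<chi> 1" using cubic_symbolD(1) [OF assms, of 1 1] by simp
  ultimately show 1: "\<chi> 1 = 1" by (auto simp: omega_powers_eq one_eis_def)
  have "\<chi> (- 1) \<in> omega_powers" by (rule cubic_symbolD(3) [OF assms]) simp
  moreover have "\<chi> 1 = \<chi> (- 1) * \<chi> (- 1)" using cubic_symbolD(1) [OF assms, of "- 1" "- 1"] by simp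
  ultimately show "\<chi> (- 1) = 1" using 1 by (auto simp: omega_powers_eq one_eis_def)
qed

lemma cubic_symbol_eq_1:
  assumes symbol: "cubic_symbol \<gamma> \<chi>"
    and primes: "\<And>q. prime q \<Longrightarrow> int q dvd m \<Longrightarrow> \<chi> (int q) = 1" and "m \<noteq> 0"
  shows "\<chi> m = 1"
  using assms(2,3)
proof (induction m rule: prime_divisors_induct)
  case (unit m)
  hence "m = 1 \<or> m = - 1" by auto
  thus ?case using cubic_symbol_1 [OF symbol] by auto
next
  case (factor q m)
  have "q > 0" using factor(1) prime_gt_0_int by blast
  then obtain q' where q': "q = int q'" using zero_less_imp_eq_int by blast
  have "\<chi> q = 1" using factor.prems(1) [of q'] factor(1) q' by simp
  moreover have "\<chi> m = 1" using factor by (intro factor.IH) auto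
  ultimately show ?case by (simp add: cubic_symbolD(1) [OF symbol])
qed simp

text \<open>Modulo a divisor \<open>q\<close> of the trace, the conjugate of \<gamma> is -\<gamma>.
  The exponent in the reciprocity law is even for odd \<open>q\<close>, and signs do not matter for
  q = 2, so both sides carry the same power of \<gamma>.\<close>

lemma cubic_symbol_trace_divisor:
  assumes symbol: "cubic_symbol \<gamma> \<chi>" and tr: "\<gamma> + conj_eis \<gamma> = of_int B"
    and q: "prime q" "int q dvd B" "\<not> int q dvd nrm \<gamma>" "q \<noteq> 3"
  shows "\<chi> (int q) = 1"
proof -
  have pq: "prime (int q)" using q(1) by simp
  have "coprime (int q) (nrm \<gamma>)" using q(3) pq prime_imp_coprime by blast
  hence om: "\<chi> (int q) \<in> omega_powers" by (rule cubic_symbolD(3) [OF symbol])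
  have conj: "congr (of_nat q) (conj_eis \<gamma>) (- \<gamma>)"
  proof -
    have "(of_int (int q) :: eis) dvd of_int B" using q(2) by (simp only: of_int_dvd_of_int_eis)
    thus ?thesis by (simp add: congr_def tr [symmetric] add.commute)
  qed
  define h where "h = conj_eis \<gamma>"
  have even_pow: "congr (of_nat q) (h ^ k) (\<gamma> ^ k)" if "even k \<or> q = 2" for k
  proof -
    have "congr (of_nat q) (h ^ k) ((- \<gamma>) ^ k)" unfolding h_def by (rule congr_power [OF conj])
    also have "congr (of_nat q) ((- \<gamma>) ^ k) (\<gamma> ^ k)"
    proof (cases "even k")
      case False
      hence "q = 2" using that by simp
      hence "- \<gamma> - \<gamma> = of_nat q * (- \<gamma>)" by simp
      hence "congr (of_nat q) (- \<gamma>) \<gamma>" unfolding congr_def by (simp only: dvd_triv_left)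
      thus ?thesis by (rule congr_power)
    qed simp
    finally show ?thesis .
  qed
  have odd_q: "odd q" if "q \<noteq> 2"
    using that q(1) primes_dvd_imp_eq two_is_prime_nat by metis
  have "q mod 3 \<noteq> 0"
    using q(1,4) primes_dvd_imp_eq [of 3 q] by (auto simp: mod_eq_0_iff_dvd)
  hence "q = 3 * (q div 3) + 1 \<or> q = 3 * (q div 3) + 2" by presburger
  then obtain m where "q = 3 * m + 1 \<or> q = 3 * m + 2" by blast
  hence "\<exists>k. congr (of_nat q) (\<gamma> ^ k) (\<chi> (int q) * \<gamma> ^ k)"
  proof
    assume m: "q = 3 * m + 1"
    have "even m \<or> q = 2" using odd_q m by presburger
    hence "congr (of_nat q) (\<chi> (int q) * h ^ m) (\<chi> (int q) * \<gamma> ^ m)"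
      by (intro congr_mult congr_refl even_pow)
    moreover have "congr (of_nat q) (\<gamma> ^ m) (\<chi> (int q) * h ^ m)"
      unfolding h_def by (rule cubic_symbolD(4) [OF symbol q(1,3) m])
    ultimately show ?thesis using congr_trans by blast
  next
    assume m: "q = 3 * m + 2"
    have "even (m + 1) \<or> q = 2" using odd_q m by presburger
    hence "congr (of_nat q) (\<gamma> ^ (m + 1)) (h ^ (m + 1))"
      by (rule congr_sym [OF even_pow])
    moreover have "congr (of_nat q) (h ^ (m + 1)) (\<chi> (int q) * \<gamma> ^ (m + 1))"
      unfolding h_def by (rule cubic_symbolD(5) [OF symbol q(1,3) m])
    ultimately show ?thesis using congr_trans by blast
  qed
  then obtain k where "congr (of_nat q) (\<gamma> ^ k) (\<chi> (int q) * \<gamma> ^ k)" by blast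
  \<comment> \<open>Multiplying by the power of the conjugate replaces the power of \<gamma> by a
    rational integer prime to \<open>q\<close>, which can be cancelled.\<close>
  hence "congr (of_nat q) (h ^ k * \<gamma> ^ k) (h ^ k * (\<chi> (int q) * \<gamma> ^ k))"
    by (intro congr_mult congr_refl)
  moreover have hk: "h ^ k * \<gamma> ^ k = of_int (nrm \<gamma> ^ k)"
    unfolding h_def power_mult_distrib [symmetric] mult.commute [of "conj_eis \<gamma>"] mult_conj_eis
    by simp
  moreover have "h ^ k * (\<chi> (int q) * \<gamma> ^ k) = (h ^ k * \<gamma> ^ k) * \<chi> (int q)"
    by (simp only: mult_ac)
  ultimately have "congr (of_int (int q)) (of_int (nrm \<gamma> ^ k) * 1) (of_int (nrm \<gamma> ^ k) * \<chi> (int q))"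
    by (simp only: of_int_of_nat_eq mult_1_right)
  moreover have "\<not> int q dvd nrm \<gamma> ^ k" using q(3) pq prime_dvd_power by blast
  ultimately have "congr (of_int (int q)) 1 (\<chi> (int q))" using congr_eis_cancel [OF pq] by blast
  hence "1 = \<chi> (int q)"
  proof (rule omega_powers_eqI [rotated 2])
    show "\<bar>int q\<bar> \<noteq> 1" using prime_gt_1_nat [OF q(1)] by simp
  qed (simp_all add: om, simp add: omega_powers_def)
  thus ?thesis by simp
qed

text \<open>Here \<open>B\<^sup>2 + 207 y\<^sup>2 = 4 a p\<close> with \<open>B = 2 a x + (2 h + 9) y\<close>, and the Eisenstein integer is
  \<open>(B - 9 y \<surd>(-3)) / 2\<close>. Its norm divides \<open>27 a p - B\<^sup>2\<close>, while its symbol is trivial at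
  every prime divisor of its trace \<open>B\<close>.\<close>

lemma form_207_symbol:
  fixes a h b x y :: int
  assumes p: "prime p" "p > 3" "p \<noteq> 23"
    and form: "int p = a * x\<^sup>2 + (2 * h + 9) * x * y + b * y\<^sup>2"
    and ab: "a * b = h\<^sup>2 + 9 * h + 72" and a: "\<not> 3 dvd a" "\<not> int p dvd a"
  defines "\<gamma> \<equiv> Eis (a * x + h * y) (- 9 * y)"
  obtains \<chi> where "cubic_symbol \<gamma> \<chi>" "nrm \<gamma> = a * int p + 9 * y\<^sup>2" "coprime a y"
    "\<not> int p dvd y" "\<not> int p dvd nrm \<gamma>" "\<not> int p dvd 2 * a * x + (2 * h + 9) * y"
    "\<chi> a * \<chi> (int p) = 1"
proof -
  define c where "c = a * x + h * y"
  define d where "d = - 9 * y"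
  \<comment> \<open>\<open>B\<close> is the trace of \<gamma>. The hypothesis on
    \<open>a * b\<close> says that (2h+9)^2 - 4ab = -207.\<close>
  define B where "B = 2 * a * x + (2 * h + 9) * y"
  define N where "N = nrm \<gamma>"
  have \<gamma>: "\<gamma> = Eis c d" by (simp add: \<gamma>_def c_def d_def)
  have pp: "prime (int p)" using p(1) by simp
  have p3: "\<not> 3 dvd int p"
  proof
    assume "3 dvd int p"
    hence "3 dvd p" by (metis int_dvd_int_iff of_nat_numeral)
    thus False using p(1,2) primes_dvd_imp_eq [of 3 p] by simp
  qed
  have B: "B = 2 * c - d" by (simp add: B_def c_def d_def algebra_simps)
  have N_cd: "N = c\<^sup>2 - c * d + d\<^sup>2" by (simp add: N_def \<gamma>)
  have N: "N = a * int p + 9 * y\<^sup>2"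
  proof -
    have "N - 9 * y\<^sup>2 = a * (a * x\<^sup>2 + (2 * h + 9) * x * y) + (h\<^sup>2 + 9 * h + 72) * y\<^sup>2"
      by (simp add: N_cd c_def d_def algebra_simps power2_eq_square)
    also have "\<dots> = a * int p"
      unfolding ab [symmetric] form by (simp add: algebra_simps)
    finally show ?thesis by simp
  qed
  have B_sq: "B\<^sup>2 + 207 * y\<^sup>2 = 4 * a * int p"
  proof -
    have "4 * N = B\<^sup>2 + 3 * d\<^sup>2" by (simp add: N_cd B algebra_simps power2_eq_square)
    thus ?thesis by (simp add: N d_def power2_eq_square)
  qed
  have N3: "\<not> 3 dvd N"
  proof
    assume "3 dvd N"
    hence "3 dvd N - 3 * (3 * y\<^sup>2)" by (intro dvd_diff) auto
    hence "3 dvd a * int p" by (simp add: N)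
    moreover have "prime (3::int)" by simp
    ultimately show False using a(1) p3 prime_dvd_mult_iff by blast
  qed
  \<comment> \<open>A common prime factor of \<open>x\<close> and \<open>y\<close> would have its
    square dividing \<open>p\<close>.\<close>
  have xy: "\<not> (r dvd x \<and> r dvd y)" if "prime r" for r
  proof
    assume r: "r dvd x \<and> r dvd y"
    then obtain u v where uv: "x = r * u" "y = r * v" by (auto elim!: dvdE)
    define f where "f = a * u\<^sup>2 + (2 * h + 9) * u * v + b * v\<^sup>2"
    have eq: "int p = r * (r * f)"
      unfolding form uv f_def by (simp add: algebra_simps power2_eq_square)
    hence "r dvd int p" by (rule dvdI)
    hence "r = int p" using that pp primes_dvd_imp_eq by blast
    with eq have "int p * 1 = int p * (int p * f)" by (simp only: mult_1_right)
    hence "1 = int p * f" using p(2) by (simp only: mult_cancel_left) simp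
    hence "is_unit (int p)" by (rule dvdI)
    thus False using pp not_prime_unit by blast
  qed
  have py: "\<not> int p dvd y"
  proof
    assume y: "int p dvd y"
    have "a * x\<^sup>2 = int p - y * ((2 * h + 9) * x + b * y)"
      unfolding form by (simp add: algebra_simps power2_eq_square)
    hence "int p dvd a * x\<^sup>2" using dvd_diff [OF dvd_refl dvd_mult2 [OF y]] by simp
    hence "int p dvd x\<^sup>2" using a(2) pp prime_dvd_mult_iff by blast
    hence "int p dvd x" using pp prime_dvd_power by blast
    thus False using y xy [OF pp] by blast
  qed
  have ay: "\<not> (r dvd a \<and> r dvd y)" if "prime r" for r
  proof
    assume r: "r dvd a \<and> r dvd y"
    hence "r dvd a * x\<^sup>2 + y * ((2 * h + 9) * x + b * y)" by (intro dvd_add dvd_mult2) auto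
    also have "a * x\<^sup>2 + y * ((2 * h + 9) * x + b * y) = int p"
      unfolding form by (simp add: algebra_simps power2_eq_square)
    finally have "r = int p" using that pp primes_dvd_imp_eq by blast
    thus False using r a(2) by blast
  qed
  have cop_ay: "coprime a y"
  proof (rule ccontr)
    assume "\<not> coprime a y"
    then obtain r where "prime r" "r dvd a" "r dvd y"
      using not_coprime_int_prime_factor by blast
    thus False using ay by blast
  qed
  have "coprime c d"
  proof (rule ccontr)
    assume "\<not> coprime c d"
    then obtain r where r: "prime r" "r dvd c" "r dvd d"
      using not_coprime_int_prime_factor by blast
    have "r dvd y \<or> r = 3"
    proof -
      have "r dvd 3 * (3 * y)" using r(3) by (simp add: d_def)
      hence "r dvd 3 \<or> r dvd y" using r(1) prime_dvd_mult_iff by blast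
      thus ?thesis using r(1) primes_dvd_imp_eq [of r 3] by auto
    qed
    thus False
    proof
      assume y: "r dvd y"
      hence "r dvd c - h * y" using r(2) by (intro dvd_diff dvd_mult) auto
      hence "r dvd a * x" by (simp add: c_def)
      hence "r dvd a \<or> r dvd x" using r(1) prime_dvd_mult_iff by blast
      thus False using y ay xy r(1) by blast
    next
      assume "r = 3"
      hence "3 dvd c * (c - d) + d * d" using r by (intro dvd_add dvd_mult2) auto
      thus False using N3 by (simp add: N_cd algebra_simps power2_eq_square)
    qed
  qed
  moreover have "3 dvd d" by (simp add: d_def)
  ultimately obtain \<chi> where symbol: "cubic_symbol \<gamma> \<chi>"
    unfolding \<gamma> using cubic_reciprocity by blast
  have pN: "\<not> int p dvd N"
  proof
    assume "int p dvd N"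
    hence "int p dvd N - int p * a" by (intro dvd_diff) auto
    hence "int p dvd 3 * (3 * (y * y))" by (simp add: N power2_eq_square)
    moreover have "\<not> int p dvd 3" using p(2) by (auto dest: zdvd_imp_le)
    ultimately show False using py by (simp only: prime_dvd_mult_iff [OF pp] simp_thms)
  qed
  \<comment> \<open>Otherwise \<open>p\<close> divides 4ap - B^2 = 207 y^2 = 23 * 9 * y^2, leaving
    only p = 23.\<close>
  have pB: "\<not> int p dvd B"
  proof
    assume "int p dvd B"
    hence "int p dvd int p * (4 * a) - B * B" by (intro dvd_diff) auto
    also have "int p * (4 * a) - B * B = 23 * (3 * (3 * (y * y)))"
      using B_sq by (simp add: power2_eq_square algebra_simps)
    finally have "int p dvd 23 * (3 * (3 * (y * y)))" .
    moreover have "\<not> int p dvd 3" using p(2) by (auto dest: zdvd_imp_le)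
    ultimately have "int p dvd 23" using py by (simp only: prime_dvd_mult_iff [OF pp] simp_thms)
    moreover have "prime (23::int)" by simp
    ultimately have "int p = 23" using pp primes_dvd_imp_eq by blast
    thus False using p(3) by simp
  qed
  \<comment> \<open>A common prime of trace and norm divides 4N - B^2 = 3 d^2; as it is not 3, it
    would divide both coordinates of \<gamma>.\<close>
  have BN: "\<not> r dvd N" if "prime r" "r dvd B" for r
  proof
    assume r: "r dvd N"
    hence "r dvd 4 * N - B * B" using that(2) by (intro dvd_diff) auto
    also have "4 * N - B * B = 3 * (d * d)" by (simp add: N_cd B algebra_simps power2_eq_square)
    finally have "r dvd 3 \<or> r dvd d" using that(1) prime_dvd_mult_iff by blast
    thus False
    proof
      assume "r dvd 3"
      hence "r = 3" using that(1) primes_dvd_imp_eq [of r 3] by auto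
      thus False using N3 r by blast
    next
      assume rd: "r dvd d"
      hence "r dvd N + d * (c - d)" using r by (intro dvd_add) auto
      also have "N + d * (c - d) = c * c" by (simp add: N_cd algebra_simps power2_eq_square)
      finally have "r dvd c" using that(1) prime_dvd_mult_iff by blast
      hence "is_unit r" using rd \<open>coprime c d\<close> coprime_common_divisor by blast
      thus False using that(1) not_prime_unit by blast
    qed
  qed
  have "\<chi> B = 1"
  proof (rule cubic_symbol_eq_1 [OF symbol])
    show "B \<noteq> 0" using pB by auto
    fix q assume q: "prime q" "int q dvd B"
    show "\<chi> (int q) = 1"
    proof (rule cubic_symbol_trace_divisor [OF symbol _ q])
      show "\<gamma> + conj_eis \<gamma> = of_int B" by (simp add: \<gamma> B of_int_eis)
      show "\<not> int q dvd nrm \<gamma>" using BN [of "int q"] q by (simp add: N_def)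
      show "q \<noteq> 3"
      proof
        assume "q = 3"
        hence "3 dvd B * B + 3 * (69 * (y * y))" using q(2) by (intro dvd_add) auto
        also have "B * B + 3 * (69 * (y * y)) = 4 * (a * int p)"
          using B_sq by (simp add: power2_eq_square)
        finally have "3 dvd 4 * (a * int p)" .
        moreover have "prime (3::int)" "\<not> (3::int) dvd 4" by simp_all
        ultimately show False using a(1) p3 prime_dvd_mult_iff by blast
      qed
    qed
  qed
  have cop3: "coprime 3 N" using N3 prime_imp_coprime [of "3::int" N] by simp
  \<comment> \<open>Eliminating y^2 between N = ap + 9y^2 and B^2 + 207y^2 = 4ap gives 27ap = 23N +
    B^2. Modulo N the cube 27 and the square of \<open>B\<close> both have trivial symbol.\<close>
  have "27 * (a * int p) = 23 * N + B * B" using B_sq by (simp add: N power2_eq_square)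
  hence "[3 * (3 * 3) * (a * int p) = B * B] (mod nrm \<gamma>)"
    by (simp add: cong_iff_dvd_diff N_def)
  hence "\<chi> (3 * (3 * 3) * (a * int p)) = \<chi> (B * B)" by (rule cubic_symbolD(2) [OF symbol])
  hence "\<chi> 3 ^ 3 * (\<chi> a * \<chi> (int p)) = 1"
    unfolding cubic_symbolD(1) [OF symbol] \<open>\<chi> B = 1\<close> by (simp add: power3_eq_cube mult.assoc)
  moreover have "\<chi> 3 ^ 3 = 1"
    using cubic_symbolD(3) [OF symbol] cop3 omega_powers_cube by (simp add: N_def)
  ultimately have "\<chi> a * \<chi> (int p) = 1" by simp
  with that symbol N pN py pB cop_ay show ?thesis unfolding N_def B_def by blast
qed

text \<open>A trivial symbol at \<open>a\<close> makes the symbol at \<open>p\<close> trivial, so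
  the trace congruence reads S B = B and \<open>B\<close> cancels. The premise \<open>triv\<close>
  is phrased for every symbol because only existence of one is known.\<close>

lemma choose_sum_cong_1:
  fixes a h b x y :: int
  assumes p: "prime p" "p > 3" "p \<noteq> 23"
    and form: "int p = a * x\<^sup>2 + (2 * h + 9) * x * y + b * y\<^sup>2"
    and ab: "a * b = h\<^sup>2 + 9 * h + 72" and a: "\<not> 3 dvd a" "\<not> int p dvd a"
    and triv: "\<And>\<chi>. cubic_symbol (Eis (a * x + h * y) (- 9 * y)) \<chi> \<Longrightarrow>
      nrm (Eis (a * x + h * y) (- 9 * y)) = a * int p + 9 * y\<^sup>2 \<Longrightarrow> coprime a y \<Longrightarrow> \<chi> a = 1"
  shows "[int (\<Sum>k = 0..p div 3. (3 * k) choose k) = 1] (mod int p)"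
proof -
  let ?\<gamma> = "Eis (a * x + h * y) (- 9 * y)"
  define B where "B = 2 * a * x + (2 * h + 9) * y"
  obtain \<chi> where \<chi>: "cubic_symbol ?\<gamma> \<chi>" "nrm ?\<gamma> = a * int p + 9 * y\<^sup>2" "coprime a y"
    "\<not> int p dvd y" "\<not> int p dvd nrm ?\<gamma>" "\<not> int p dvd 2 * a * x + (2 * h + 9) * y"
    "\<chi> a * \<chi> (int p) = 1"
    by (rule form_207_symbol [OF p form ab a])
  have "\<chi> a = 1" by (rule triv [OF \<chi>(1-3)])
  hence "\<chi> (int p) * ?\<gamma> = ?\<gamma>" using \<chi>(7) by simp
  moreover have "int p dvd 9 * nrm ?\<gamma> - (- 9 * y)\<^sup>2"
    unfolding \<chi>(2) by (simp add: power2_eq_square algebra_simps)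
  ultimately have "[int (\<Sum>k = 0..p div 3. (3 * k) choose k) * (2 * (a * x + h * y) - (- 9 * y))
      = 2 * (a * x + h * y) - (- 9 * y)] (mod int p)"
    using \<chi>(1,5) by (intro choose_sum_cong_trace [OF p(1,2)])
  moreover have "2 * (a * x + h * y) - (- 9 * y) = B" by (simp add: B_def algebra_simps)
  ultimately have "[int (\<Sum>k = 0..p div 3. (3 * k) choose k) * B = 1 * B] (mod int p)"
    by (simp only: mult_1_left)
  moreover have "coprime B (int p)"
  proof -
    have "prime (int p)" using p(1) by simp
    thus ?thesis using \<chi>(6) prime_imp_coprime coprime_commute unfolding B_def by blast
  qed
  ultimately show ?thesis using cong_mult_rcancel by blast
qed

text \<open>Modulo the leading coefficient \<open>q\<close>, \<gamma> is y times h - 9 \<omega>. The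
  rational scalar appears to the same power on both sides of the reciprocity law and cancels, so the
  symbol at \<open>q\<close> depends only on \<open>q\<close> and \<open>h\<close>, not on
  \<open>x\<close> and \<open>y\<close>.\<close>

lemma cubic_symbol_at_prime_coefficient:
  fixes h x y :: int and q :: nat
  assumes symbol: "cubic_symbol (Eis (int q * x + h * y) (- 9 * y)) \<chi>"
    and nrm_eq: "nrm (Eis (int q * x + h * y) (- 9 * y)) = int q * m + 9 * y\<^sup>2"
    and q: "prime q" "q > 3" "coprime (int q) y"
  shows "\<chi> (int q) \<in> omega_powers"
    and "q = 3 * k + 1 \<Longrightarrow>
      congr (of_int (int q)) (Eis h (- 9) ^ k) (\<chi> (int q) * conj_eis (Eis h (- 9)) ^ k)"
    and "q = 3 * k + 2 \<Longrightarrow>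
      congr (of_int (int q)) (conj_eis (Eis h (- 9)) ^ (k + 1)) (\<chi> (int q) * Eis h (- 9) ^ (k + 1))"
proof -
  define \<gamma> where "\<gamma> = Eis (int q * x + h * y) (- 9 * y)"
  define G where "G = Eis h (- 9)"
  have pq: "prime (int q)" using q(1) by simp
  have qy: "\<not> int q dvd y"
    using q(3) pq by (metis coprime_absorb_left not_prime_unit)
  have nd: "\<not> int q dvd nrm \<gamma>"
  proof
    assume "int q dvd nrm \<gamma>"
    hence "int q dvd nrm \<gamma> - int q * m" by (intro dvd_diff) auto
    also have "nrm \<gamma> - int q * m = 3 * (3 * (y * y))"
      unfolding \<gamma>_def nrm_eq by (simp add: power2_eq_square)
    finally have "int q dvd 3 * (3 * (y * y))" .
    moreover have "\<not> int q dvd 3" using q(2) by (auto dest: zdvd_imp_le)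
    ultimately show False using qy by (simp only: prime_dvd_mult_iff [OF pq] simp_thms)
  qed
  hence "coprime (int q) (nrm \<gamma>)" using pq prime_imp_coprime by blast
  thus "\<chi> (int q) \<in> omega_powers" using cubic_symbolD(3) [OF symbol] by (simp add: \<gamma>_def)
  have "\<gamma> - of_int y * G = of_int (int q) * Eis x 0"
    by (simp add: \<gamma>_def G_def of_int_eis of_nat_eis)
  hence \<gamma>: "congr (of_int (int q)) \<gamma> (of_int y * G)"
    unfolding congr_def by (simp only: dvd_triv_left)
  hence \<gamma>k: "congr (of_int (int q)) (\<gamma> ^ j) (of_int (y ^ j) * G ^ j)" for j
    using congr_power [OF \<gamma>, of j] by (simp add: power_mult_distrib)
  have \<gamma>ck: "congr (of_int (int q)) (conj_eis \<gamma> ^ j) (of_int (y ^ j) * conj_eis G ^ j)" for j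
    using congr_conj_eis [OF \<gamma>k [of j]] by (simp only: conj_eis_mult conj_eis_power conj_eis_of_int)
  have yk: "\<not> int q dvd y ^ j" for j using qy pq prime_dvd_power by blast
  show "congr (of_int (int q)) (Eis h (- 9) ^ k) (\<chi> (int q) * conj_eis (Eis h (- 9)) ^ k)"
    if k: "q = 3 * k + 1"
  proof -
    have "congr (of_int (int q)) (of_int (y ^ k) * G ^ k) (\<gamma> ^ k)" by (rule congr_sym [OF \<gamma>k])
    also have "congr (of_int (int q)) (\<gamma> ^ k) (\<chi> (int q) * conj_eis \<gamma> ^ k)"
      using cubic_symbolD(4) [OF symbol q(1) _ k] nd by (simp add: \<gamma>_def)
    also have "congr (of_int (int q)) \<dots> (\<chi> (int q) * (of_int (y ^ k) * conj_eis G ^ k))"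
      by (rule congr_mult [OF congr_refl \<gamma>ck])
    also have "\<chi> (int q) * (of_int (y ^ k) * conj_eis G ^ k)
        = of_int (y ^ k) * (\<chi> (int q) * conj_eis G ^ k)" by (simp only: mult_ac)
    finally show ?thesis unfolding G_def using congr_eis_cancel [OF pq yk] by blast
  qed
  show "congr (of_int (int q)) (conj_eis (Eis h (- 9)) ^ (k + 1)) (\<chi> (int q) * Eis h (- 9) ^ (k + 1))"
    if k: "q = 3 * k + 2"
  proof -
    have "congr (of_int (int q)) (of_int (y ^ (k + 1)) * conj_eis G ^ (k + 1)) (conj_eis \<gamma> ^ (k + 1))"
      by (rule congr_sym [OF \<gamma>ck])
    also have "congr (of_int (int q)) (conj_eis \<gamma> ^ (k + 1)) (\<chi> (int q) * \<gamma> ^ (k + 1))"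
      using cubic_symbolD(5) [OF symbol q(1) _ k] nd
      by (simp only: \<gamma>_def of_int_of_nat_eq not_False_eq_True)
    also have "congr (of_int (int q)) \<dots> (\<chi> (int q) * (of_int (y ^ (k + 1)) * G ^ (k + 1)))"
      by (rule congr_mult [OF congr_refl \<gamma>k])
    also have "\<chi> (int q) * (of_int (y ^ (k + 1)) * G ^ (k + 1))
        = of_int (y ^ (k + 1)) * (\<chi> (int q) * G ^ (k + 1))" by (simp only: mult_ac)
    finally show ?thesis unfolding G_def using congr_eis_cancel [OF pq yk] by blast
  qed
qed

section \<open>Explicit symbols at the leading coefficients 13 and 29\<close>

lemma symbol_13:
  assumes "z \<in> omega_powers"
    and "congr (of_int (int 13)) (Eis (- 4) (- 9) ^ 4) (z * conj_eis (Eis (- 4) (- 9)) ^ 4)"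
  shows "z = \<omega>"
  using assms(1) assms(2) [unfolded of_nat_numeral]
  by (auto simp: omega_powers_eq \<omega>_def congr_def eval_nat_numeral of_int_dvd_Eis_iff
      simp del: of_int_numeral)

lemma symbol_29:
  assumes "z \<in> omega_powers"
    and "congr (of_int (int 29)) (conj_eis (Eis (- 2) (- 9)) ^ (9 + 1)) (z * Eis (- 2) (- 9) ^ (9 + 1))"
  shows "z = \<omega>\<^sup>2"
proof -
  \<comment> \<open>The tenth power is arranged as repeated squaring, 10 = 2 (2 * 2 + 1), for
    evaluation on explicit coordinates.\<close>
  have "Eis (- 2) (- 9) ^ 10 = ((Eis (- 2) (- 9) ^ 2) ^ 2 * Eis (- 2) (- 9)) ^ 2"
    "conj_eis (Eis (- 2) (- 9)) ^ 10
      = ((conj_eis (Eis (- 2) (- 9)) ^ 2) ^ 2 * conj_eis (Eis (- 2) (- 9))) ^ 2"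
    by (simp_all only: power_mult [symmetric] power_Suc2 [symmetric]) simp_all
  moreover have "congr (of_int 29) (conj_eis (Eis (- 2) (- 9)) ^ 10) (z * Eis (- 2) (- 9) ^ 10)"
    using assms(2) by simp
  ultimately show ?thesis
    using assms(1)
    by (auto simp: omega_powers_eq \<omega>_def congr_def power2_eq_square of_int_dvd_Eis_iff
        simp del: of_int_numeral)
qed

section \<open>The congruence for the individual forms\<close>

theorem theorem3p8:
  fixes p :: nat
  assumes "prime p" and "p > 3" and "Legendre (int p) 23 = 1"
  defines "S \<equiv> int (\<Sum>k = 0..p div 3. (3 * k) choose k)"
  shows "((\<exists>x y :: int. int p = x\<^sup>2 + x * y + 52 * y\<^sup>2) \<or>
          (\<exists>x y :: int. int p = 8 * x\<^sup>2 + 7 * x * y + 8 * y\<^sup>2)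
            \<longrightarrow> [S = 1] (mod int p))
       \<and> (\<forall>x y :: int. int p = 13 * x\<^sup>2 + x * y + 4 * y\<^sup>2 \<and> p \<noteq> 13
            \<longrightarrow> [S = quot_mod (int p) (39 * x - 10 * y) (23 * y)] (mod int p))
       \<and> (\<forall>x y :: int. int p = 29 * x\<^sup>2 + 5 * x * y + 2 * y\<^sup>2 \<and> p \<noteq> 29
            \<longrightarrow> [S = - quot_mod (int p) (87 * x + 19 * y) (23 * y)] (mod int p))"
proof -
  have pp: "prime (int p)" using assms(1) by simp
  have p23: "p \<noteq> 23"
  proof
    assume "p = 23"
    hence "Legendre (int p) 23 = 0" by (simp add: Legendre_def cong_def)
    thus False using assms(3) by simp
  qed
  note p = assms(1,2) p23
  have p_ndvd: "\<not> int p dvd int q" if "prime q" "p \<noteq> q" for q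
    using that assms(1) primes_dvd_imp_eq int_dvd_int_iff by metis
  have p_ndvd2: "\<not> int p dvd 2" using p_ndvd [of 2] p(2) by simp
  have p_ndvd3: "\<not> int p dvd 3" using p_ndvd [of 3] p(2) by simp
  have p_ndvd23: "\<not> int p dvd 23" using p_ndvd [of 23] p23 by simp
  have coprime_23y: "coprime (23 * y) (int p)" if "\<not> int p dvd y" for y
  proof -
    have "\<not> int p dvd 23 * y" using that p_ndvd23 by (simp only: prime_dvd_mult_iff [OF pp] simp_thms)
    thus ?thesis using pp prime_imp_coprime coprime_commute by blast
  qed
  have cancel_9y: "int p dvd u" if "int p dvd 9 * y * u" "\<not> int p dvd y" for u y
  proof -
    have "int p dvd 3 * (3 * (y * u))" using that(1) by (simp add: mult_ac)
    thus ?thesis using that(2) p_ndvd3 by (simp only: prime_dvd_mult_iff [OF pp] simp_thms)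
  qed
  \<comment> \<open>In each case \<open>h\<close> is fixed by setting 2h + 9 equal to the middle
    coefficient: -4, -1, -4 and -2 for the forms in their order of appearance. Here the leading
    coefficient 1 has trivial symbol.\<close>
  have c1: "[S = 1] (mod int p)" if "int p = x\<^sup>2 + x * y + 52 * y\<^sup>2" for x y
    unfolding S_def
    by (rule choose_sum_cong_1 [OF p, of 1 x "- 4" y 52])
       (use that cubic_symbol_1 prime_gt_1_nat [OF p(1)] in auto)
  have c2: "[S = 1] (mod int p)" if form: "int p = 8 * x\<^sup>2 + 7 * x * y + 8 * y\<^sup>2" for x y
    unfolding S_def
  proof (rule choose_sum_cong_1 [OF p, of 8 x "- 1" y 8])
    show "\<not> int p dvd 8"
    proof
      assume "int p dvd 8"
      hence "int p dvd 2 * (2 * 2)" by simp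
      thus False using p_ndvd2 by (simp only: prime_dvd_mult_iff [OF pp] simp_thms)
    qed
  next
    let ?\<gamma> = "Eis (8 * x + (- 1) * y) (- 9 * y)"
    fix \<chi> assume \<chi>: "cubic_symbol ?\<gamma> \<chi>" and N: "nrm ?\<gamma> = 8 * int p + 9 * y\<^sup>2"
      and "coprime 8 y"
    \<comment> \<open>The coefficient 8 is the cube of 2, so its symbol is trivial as soon as 2 is
      prime to the norm 8p + 9y^2, that is, as soon as \<open>y\<close> is odd.\<close>
    hence "odd y" by (metis coprime_common_divisor dvd_trans odd_one even_numeral)
    hence "odd (nrm ?\<gamma>)" unfolding N by simp
    hence "coprime 2 (nrm ?\<gamma>)" by (simp add: coprime_left_2_iff_odd)
    hence "\<chi> 2 ^ 3 = 1" using cubic_symbolD(3) [OF \<chi>] omega_powers_cube by blast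
    moreover have "\<chi> 8 = \<chi> 2 ^ 3"
      using cubic_symbolD(1) [OF \<chi>, of 2 4] cubic_symbolD(1) [OF \<chi>, of 2 2]
      by (simp add: power3_eq_cube mult.assoc)
    ultimately show "\<chi> 8 = 1" by simp
  qed (use form in auto)
  have c3: "[S = quot_mod (int p) (39 * x - 10 * y) (23 * y)] (mod int p)"
    if form: "int p = 13 * x\<^sup>2 + x * y + 4 * y\<^sup>2" and "p \<noteq> 13" for x y
  proof -
    let ?\<gamma> = "Eis (int 13 * x + (- 4) * y) (- 9 * y)"
    have form': "int p = int 13 * x\<^sup>2 + (2 * (- 4) + 9) * x * y + 4 * y\<^sup>2" using form by simp
    have ab: "int 13 * 4 = (- 4)\<^sup>2 + 9 * (- 4) + 72" and a: "\<not> 3 dvd int 13" "\<not> int p dvd int 13"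
      using p_ndvd [of 13] \<open>p \<noteq> 13\<close> by simp_all
    obtain \<chi> where \<chi>: "cubic_symbol ?\<gamma> \<chi>" "nrm ?\<gamma> = int 13 * int p + 9 * y\<^sup>2"
      "coprime (int 13) y" "\<not> int p dvd y" "\<not> int p dvd nrm ?\<gamma>"
      "\<not> int p dvd 2 * int 13 * x + (2 * (- 4) + 9) * y" "\<chi> (int 13) * \<chi> (int p) = 1"
      by (rule form_207_symbol [OF p form' ab a])
    have "\<chi> (int 13) = \<omega>"
    proof (rule symbol_13)
      have q: "prime (13::nat)" "(13::nat) > 3" "(13::nat) = 3 * 4 + 1" by simp_all
      note * = cubic_symbol_at_prime_coefficient [OF \<chi>(1,2) q(1,2) \<chi>(3)]
      show "\<chi> (int 13) \<in> omega_powers" by (rule *(1))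
      show "congr (of_int (int 13)) (Eis (- 4) (- 9) ^ 4) (\<chi> (int 13) * conj_eis (Eis (- 4) (- 9)) ^ 4)" by (rule *(2) [OF q(3)])
    qed
    hence "\<omega> * \<chi> (int p) = 1" using \<chi>(7) by simp
    hence "\<omega> ^ 3 * \<chi> (int p) = \<omega> ^ 2" by (simp add: power3_eq_cube power2_eq_square mult.assoc)
    hence "\<chi> (int p) = Eis (- 1) (- 1)" by (simp add: omega_power)
    hence "\<chi> (int p) * ?\<gamma> = Eis (- 13 * x - 5 * y) (- 13 * x + 4 * y)"
      by (simp add: algebra_simps)
    moreover have "int p dvd 9 * nrm ?\<gamma> - (- 9 * y)\<^sup>2"
      unfolding \<chi>(2) by (simp add: power2_eq_square algebra_simps)
    ultimately have "[S * (2 * (int 13 * x + (- 4) * y) - (- 9 * y))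
        = 2 * (- 13 * x - 5 * y) - (- 13 * x + 4 * y)] (mod int p)"
      unfolding S_def using \<chi>(1,5) by (intro choose_sum_cong_trace [OF p(1,2)])
    hence d: "int p dvd S * (26 * x + y) - (- 13 * x - 14 * y)"
      by (simp add: cong_iff_dvd_diff algebra_simps)
    \<comment> \<open>The trace congruence has denominator 26x + y. Multiplying it by 26x + y and
      using (26x + y)^2 + 207y^2 = 52p exchanges this for the denominator 23y, up to the unit factor
      9y.\<close>
    have "9 * y * (S * (23 * y) - (39 * x - 10 * y))
        = int p * (52 * S + 26) - (26 * x + y) * (S * (26 * x + y) - (- 13 * x - 14 * y))"
      unfolding form by (simp add: algebra_simps power2_eq_square)
    also have "int p dvd \<dots>" by (rule dvd_diff [OF dvd_triv_left dvd_mult [OF d]])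
    finally have "int p dvd S * (23 * y) - (39 * x - 10 * y)" by (rule cancel_9y [OF _ \<chi>(4)])
    thus ?thesis
      using quot_mod_cong_iff [OF coprime_23y [OF \<chi>(4)]] by (simp add: cong_iff_dvd_diff)
  qed
  have c4: "[S = - quot_mod (int p) (87 * x + 19 * y) (23 * y)] (mod int p)"
    if form: "int p = 29 * x\<^sup>2 + 5 * x * y + 2 * y\<^sup>2" and "p \<noteq> 29" for x y
  proof -
    let ?\<gamma> = "Eis (int 29 * x + (- 2) * y) (- 9 * y)"
    have form': "int p = int 29 * x\<^sup>2 + (2 * (- 2) + 9) * x * y + 2 * y\<^sup>2" using form by simp
    have ab: "int 29 * 2 = (- 2)\<^sup>2 + 9 * (- 2) + 72" and a: "\<not> 3 dvd int 29" "\<not> int p dvd int 29"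
      using p_ndvd [of 29] \<open>p \<noteq> 29\<close> by simp_all
    obtain \<chi> where \<chi>: "cubic_symbol ?\<gamma> \<chi>" "nrm ?\<gamma> = int 29 * int p + 9 * y\<^sup>2"
      "coprime (int 29) y" "\<not> int p dvd y" "\<not> int p dvd nrm ?\<gamma>"
      "\<not> int p dvd 2 * int 29 * x + (2 * (- 2) + 9) * y" "\<chi> (int 29) * \<chi> (int p) = 1"
      by (rule form_207_symbol [OF p form' ab a])
    have "\<chi> (int 29) = \<omega>\<^sup>2"
    proof (rule symbol_29)
      have q: "prime (29::nat)" "(29::nat) > 3" "(29::nat) = 3 * 9 + 2" by simp_all
      note * = cubic_symbol_at_prime_coefficient [OF \<chi>(1,2) q(1,2) \<chi>(3)]
      show "\<chi> (int 29) \<in> omega_powers" by (rule *(1))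
      show "congr (of_int (int 29)) (conj_eis (Eis (- 2) (- 9)) ^ (9 + 1)) (\<chi> (int 29) * Eis (- 2) (- 9) ^ (9 + 1))" by (rule *(3) [OF q(3)])
    qed
    hence "\<omega>\<^sup>2 * \<chi> (int p) = 1" using \<chi>(7) by simp
    hence "\<omega> ^ 3 * \<chi> (int p) = \<omega>" by (simp add: power3_eq_cube power2_eq_square mult.assoc)
    hence "\<chi> (int p) = Eis 0 1" by (simp add: omega_power) (simp add: \<omega>_def)
    hence "\<chi> (int p) * ?\<gamma> = Eis (9 * y) (29 * x + 7 * y)"
      by (simp add: algebra_simps)
    moreover have "int p dvd 9 * nrm ?\<gamma> - (- 9 * y)\<^sup>2"
      unfolding \<chi>(2) by (simp add: power2_eq_square algebra_simps)
    ultimately have "[S * (2 * (int 29 * x + (- 2) * y) - (- 9 * y))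
        = 2 * (9 * y) - (29 * x + 7 * y)] (mod int p)"
      unfolding S_def using \<chi>(1,5) by (intro choose_sum_cong_trace [OF p(1,2)])
    hence d: "int p dvd S * (58 * x + 5 * y) - (11 * y - 29 * x)"
      by (simp add: cong_iff_dvd_diff algebra_simps)
    \<comment> \<open>The same change of denominator, now through (58x + 5y)^2 + 207y^2 =
      116p.\<close>
    have "9 * y * (- S * (23 * y) - (87 * x + 19 * y))
        = (58 * x + 5 * y) * (S * (58 * x + 5 * y) - (11 * y - 29 * x)) - int p * (116 * S + 58)"
      unfolding form by (simp add: algebra_simps power2_eq_square)
    also have "int p dvd \<dots>" by (rule dvd_diff [OF dvd_mult [OF d] dvd_triv_left])
    finally have "int p dvd - S * (23 * y) - (87 * x + 19 * y)" by (rule cancel_9y [OF _ \<chi>(4)])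
    hence "[- S = quot_mod (int p) (87 * x + 19 * y) (23 * y)] (mod int p)"
      using quot_mod_cong_iff [OF coprime_23y [OF \<chi>(4)]] by (simp add: cong_iff_dvd_diff)
    thus ?thesis using cong_minus_minus_iff by fastforce
  qed
  show ?thesis using c1 c2 c3 c4 by blast
qed

end
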